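(* Let $G$ be a countable linear sofic group. Then there exist a non-principal ultrafilter $\omega'$ on $\mathbb{N}$, a sequence $m_k\to\infty$ and a group morphism $\Psi:G\to\prod_{k\to\omega'}GL_{m_k}(\mathbb{C})/d_{\omega'}$ such that $d_{\omega'}(\Psi(g),\mathrm{Id})\geqslant\frac14$ for every $g\in G\setminus\{e\}$.
   Context: For $a\in M_n(\mathbb{C})$, $\rho(a)=\operatorname{rk}(a)/n$. For a non-principal ultrafilter $\omega$ on $\mathbb{N}$ and $n_k\to\infty$, $\prod_{k\to\omega}GL_{n_k}(\mathbb{C})/d_\omega$ is the quotient of $\prod_kGL_{n_k}(\mathbb{C})$ by $\{(a_k)_k:\lim_{k\to\omega}\rho(a_k-\mathrm{Id})=0\}$, with metric $d_\omega((a_k),(b_k))=\lim_{k\to\omega}\rho(a_k-b_k)$. A countable group is linear sofic if it admits an injective group morphism into some $\prod_{k\to\omega}GL_{n_k}(\mathbb{C})/d_\omega$. *)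

theory Defs
  imports "HOL-Analysis.Analysis" "HOL-Algebra.Coset" "Jordan_Normal_Form.DL_Rank"
begin

definition ultrafilter_on_nat :: "nat filter \<Rightarrow> bool" where
  "ultrafilter_on_nat F \<longleftrightarrow> F \<noteq> bot \<and> (\<forall>P. eventually P F \<or> eventually (\<lambda>x. \<not> P x) F)"

definition nonprincipal_ultrafilter :: "nat filter \<Rightarrow> bool" where
  "nonprincipal_ultrafilter F \<longleftrightarrow> ultrafilter_on_nat F \<and> (\<forall>i. \<not> eventually (\<lambda>k. k = i) F)"

definition rho :: "complex mat \<Rightarrow> real" where
  "rho A = real (vec_space.rank (dim_row A) A) / real (dim_row A)"

definition prodGL :: "(nat \<Rightarrow> nat) \<Rightarrow> (nat \<Rightarrow> complex mat) monoid" where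
  "prodGL n = \<lparr>carrier = {a. \<forall>k. a k \<in> carrier_mat (n k) (n k) \<and> invertible_mat (a k)},
               monoid.mult = (\<lambda>a b k. a k * b k),
               one = (\<lambda>k. 1\<^sub>m (n k))\<rparr>"

definition nullGL :: "nat filter \<Rightarrow> (nat \<Rightarrow> nat) \<Rightarrow> (nat \<Rightarrow> complex mat) set" where
  "nullGL \<omega> n = {a \<in> carrier (prodGL n). ((\<lambda>k. rho (a k - 1\<^sub>m (n k))) \<longlongrightarrow> 0) \<omega>}"

definition ultraGL :: "nat filter \<Rightarrow> (nat \<Rightarrow> nat) \<Rightarrow> (nat \<Rightarrow> complex mat) set monoid" where
  "ultraGL \<omega> n = prodGL n Mod nullGL \<omega> n"

definition d_omega :: "nat filter \<Rightarrow> (nat \<Rightarrow> complex mat) set \<Rightarrow> (nat \<Rightarrow> complex mat) set \<Rightarrow> real" where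
  "d_omega \<omega> X Y = Lim \<omega> (\<lambda>k. rho ((SOME a. a \<in> X) k - (SOME b. b \<in> Y) k))"

definition linear_sofic :: "('g, 'b) monoid_scheme \<Rightarrow> bool" where
  "linear_sofic G \<longleftrightarrow> (\<exists>\<omega> n \<phi>. nonprincipal_ultrafilter \<omega> \<and> filterlim n at_top sequentially \<and>
      \<phi> \<in> hom G (ultraGL \<omega> n) \<and> inj_on \<phi> (carrier G))"

end

theory Submission
  imports Defs "Jordan_Normal_Form.Schur_Decomposition"
begin

text \<open>Write \<open>D(A)\<close> for the minimum over all scalars \<open>c\<close> of the normalized rank of \<open>A - c\<close>.
  For an invertible matrix \<open>A\<close>, the tensor square satisfies
  \<open>D(A \<otimes> A) \<ge> min (5/4 D(A)) (1/4)\<close>. If \<open>D(A) \<ge> 1/4\<close>, this follows by bringing one tensor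
  factor into upper triangular form. If \<open>A - a\<close> has normalized rank \<open>r < 1/4\<close>, then the kernel of
  \<open>A - a\<close> is large: \<open>A \<otimes> A - a\<^sup>2\<close> has normalized rank at least \<open>2r - 3r\<^sup>2\<close>, and
  \<open>A \<otimes> A - c\<close> has normalized rank at least \<open>(1 - r)\<^sup>2\<close> for all other scalars \<open>c\<close>.
  Replacing \<open>A\<close> by \<open>A \<oplus> 1\<close> turns a lower bound for the rank of \<open>A - 1\<close> into one for \<open>D\<close>, so
  sufficiently many tensor squarings move a nontrivial group element to distance \<open>1/4\<close> from the
  identity. They are multiplicative and Lipschitz for the normalized rank, and \<open>G\<close> is countable, so a
  diagonal choice of the number of squarings and of the coordinate \<open>k\<close> gives the new morphism.\<close>

text \<open>Distance to the identity alone need not survive tensor squaring: \<open>A = -1\<close>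
  is as far from the identity as possible, yet its tensor square is the identity. Distance to all
  scalars does survive, and the summand 1 provides it: a scalar close to both \<open>A\<close> and 1
  can only be 1 itself. Invertibility excludes the eigenvalue a = 0, where a small normalized rank r
  would shrink to r^2. Two regimes are needed because the kernel argument wants a large eigenspace,
  while triangularization only gives D(A \<otimes> A) \<ge> D(A): no growth, but enough to keep 1/4
  once it is reached. The factor 5/4 is the value of 2 - 3r at r = 1/4. Each squaring may double the
  error of multiplicativity, so the number N of squarings has to be fixed before choosing a
  coordinate whose error is small against 2^(-N). The estimates for the new sequence hold at all
  large indices, so the given ultrafilter can be kept.\<close>

section \<open>Rank through factorizations and two-sided certificates\<close>

definition mrank :: "'a::field mat \<Rightarrow> nat" where
  "mrank A = vec_space.rank (dim_row A) A"

text \<open>Padding \<open>H\<close> with zero rows gives a square matrix whose row \<open>r\<close>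
  vanishes, so its transpose kills a unit vector and the determinant is 0.\<close>

lemma wide_mat_kernel:
  fixes H :: "'a::field mat"
  assumes H: "H \<in> carrier_mat r s" and "r < s"
  shows "\<exists>v\<in>carrier_vec s. v \<noteq> 0\<^sub>v s \<and> H *\<^sub>v v = 0\<^sub>v r"
proof -
  define H' where "H' = mat s s (\<lambda>(i,j). if i < r then H $$ (i,j) else 0)"
  have H': "H' \<in> carrier_mat s s" by (simp add: H'_def)
  have "transpose_mat H' *\<^sub>v unit_vec s r = 0\<^sub>v s"
  proof (rule eq_vecI)
    fix i assume i: "i < dim_vec (0\<^sub>v s :: 'a vec)"
    then have "col H' i \<in> carrier_vec s" using H' by auto
    then show "(transpose_mat H' *\<^sub>v unit_vec s r) $ i = 0\<^sub>v s $ i"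
      using i \<open>r < s\<close> H' by (simp add: scalar_prod_right_unit) (simp add: H'_def)
  qed (use H' in auto)
  moreover have "unit_vec s r \<noteq> (0\<^sub>v s :: 'a vec)"
    using \<open>r < s\<close> by (metis index_unit_vec(2) index_zero_vec(1) zero_neq_one)
  ultimately have "det (transpose_mat H') = 0"
    using det_0_iff_vec_prod_zero[of "transpose_mat H'" s] H' unit_vec_carrier[of s r]
    by (metis transpose_carrier_mat)
  then have "det H' = 0" using H' det_transpose by metis
  then obtain v where v: "v \<in> carrier_vec s" "v \<noteq> 0\<^sub>v s" "H' *\<^sub>v v = 0\<^sub>v s"
    using det_0_iff_vec_prod_zero[OF H'] by auto
  have "H *\<^sub>v v = 0\<^sub>v r"
  proof (rule eq_vecI)
    fix i assume "i < dim_vec (0\<^sub>v r :: 'a vec)"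
    then have i: "i < r" by simp
    have "row H i = row H' i"
      using i \<open>r < s\<close> H by (intro eq_vecI) (auto simp: H'_def)
    moreover have "scalar_prod (row H' i) v = (H' *\<^sub>v v) $ i" using i \<open>r < s\<close> H' by simp
    ultimately show "(H *\<^sub>v v) $ i = 0\<^sub>v r $ i" using i \<open>r < s\<close> H v(3) by simp
  qed (use H in auto)
  with v show ?thesis by auto
qed

lemma one_mat_factor_le:
  fixes P :: "'a::field mat"
  assumes "P \<in> carrier_mat r s" "Q \<in> carrier_mat s r" "P * Q = 1\<^sub>m r"
  shows "r \<le> s"
proof (rule ccontr)
  assume "\<not> r \<le> s"
  then obtain v where v: "v \<in> carrier_vec r" "v \<noteq> 0\<^sub>v r" "Q *\<^sub>v v = 0\<^sub>v s"
    using wide_mat_kernel[OF assms(2)] by auto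
  have "v = (P * Q) *\<^sub>v v" using assms(3) v by simp
  also have "\<dots> = P *\<^sub>v (Q *\<^sub>v v)" using assms(1,2) v by simp
  also have "\<dots> = 0\<^sub>v r" using assms(1) by (auto simp: v(3) intro!: eq_vecI)
  finally show False using v by simp
qed

text \<open>\<open>C\<close> consists of a maximal independent set of columns of \<open>M\<close>.
  That its columns are columns of \<open>M\<close> and that it is injective serves the upper bound
  on the rank by factorizations; that it spans all columns serves the lower bound.\<close>

lemma mrank_basis:
  fixes M :: "'a::field mat"
  assumes M: "M \<in> carrier_mat n m"
  obtains C where "C \<in> carrier_mat n (mrank M)" "set (cols C) \<subseteq> set (cols M)"
    "\<And>v. v \<in> carrier_vec (mrank M) \<Longrightarrow> C *\<^sub>v v = 0\<^sub>v n \<Longrightarrow> v = 0\<^sub>v (mrank M)"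
    "\<And>j. j < m \<Longrightarrow> \<exists>v\<in>carrier_vec (mrank M). col M j = C *\<^sub>v v"
proof -
  interpret vec_space "TYPE('a)" n .
  have rk: "mrank M = rank M" using M by (simp add: mrank_def)
  obtain S where S: "maximal S (\<lambda>T. T \<subseteq> set (cols M) \<and> lin_indpt T)" 
    using maximal_exists_superset[of "set (cols M)" "\<lambda>T. T \<subseteq> set (cols M) \<and> lin_indpt T" "{}"]
      finite_lin_indpt2[of "{}"] by auto
  have Ssub: "S \<subseteq> set (cols M)" and Sind: "lin_indpt S" using S by (auto simp: maximal_def)
  have Scar: "S \<subseteq> carrier_vec n" using Ssub cols_dim M by blast
  obtain cs where cs: "set cs = S" "distinct cs"
    using finite_distinct_list[of S] finite_subset[OF Ssub] by auto
  have len: "length cs = mrank M" unfolding rk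
    using rank_card_indpt[OF M S] cs distinct_card by metis
  define C where "C = mat_of_cols n cs"
  have C: "C \<in> carrier_mat n (mrank M)" by (simp add: C_def len[symmetric])
  have colsC: "cols C = cs" unfolding C_def
    using Scar cs by (intro cols_mat_of_cols) auto
  show thesis
  proof
    show "C \<in> carrier_mat n (mrank M)" by fact
    show "set (cols C) \<subseteq> set (cols M)" using colsC cs Ssub by simp
    show "v = 0\<^sub>v (mrank M)" if "v \<in> carrier_vec (mrank M)" "C *\<^sub>v v = 0\<^sub>v n" for v
      using lin_depI[OF C that(1) _ that(2)] colsC cs Sind by auto
    show "\<exists>v\<in>carrier_vec (mrank M). col M j = C *\<^sub>v v" if j: "j < m" for j
    proof -
      have cj: "col M j \<in> set (cols M)" using M j
        by (metis carrier_matD(2) cols_length cols_nth nth_mem)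
      then have cjc: "col M j \<in> carrier_vec n" using M by auto
      have "col M j \<in> span S"
      proof (cases "col M j \<in> S")
        case True then show ?thesis using Scar span_mem by auto
      next
        case False
        then have "\<not> lin_indpt (insert (col M j) S)"
          using S cj unfolding maximal_def by blast
        then show ?thesis 
          using lin_dep_iff_in_span[OF Scar Sind cjc False] by auto
      qed
      then obtain a where "col M j = lincomb a S" 
        using finite_in_span[of S "col M j"] finite_subset[OF Ssub] Scar by (metis List.finite_set)
      then have "col M j = C *\<^sub>v vec (mrank M) (\<lambda>i. a (col C i))"
        using mat_mult_eq_lincomb[OF C, of a] colsC cs by simp
      then show ?thesis by (intro bexI) auto
    qed
  qed
qed

text \<open>Otherwise the independent columns of \<open>F * H\<close> would form a product
  \<open>F * H'\<close> with \<open>H'\<close> wider than high, and a kernel vector of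
  \<open>H'\<close> would contradict their independence.\<close>

lemma mrank_le_of_factor:
  fixes F :: "'a::field mat"
  assumes F: "F \<in> carrier_mat n r" and H: "H \<in> carrier_mat r m"
  shows "mrank (F * H) \<le> r"
proof (rule ccontr)
  assume less: "\<not> mrank (F * H) \<le> r"
  let ?s = "mrank (F * H)"
  have M: "F * H \<in> carrier_mat n m" using F H by simp
  obtain C where C: "C \<in> carrier_mat n ?s" "set (cols C) \<subseteq> set (cols (F * H))"
    and ker: "\<And>v. v \<in> carrier_vec ?s \<Longrightarrow> C *\<^sub>v v = 0\<^sub>v n \<Longrightarrow> v = 0\<^sub>v ?s"
    using mrank_basis[OF M] by metis
  have "\<exists>k<m. col C j = col (F * H) k" if "j < ?s" for j
  proof -
    have "col C j \<in> set (cols (F * H))" using C that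
      by (metis carrier_matD(2) cols_length cols_nth nth_mem subsetD)
    then obtain k where "k < length (cols (F * H))" "cols (F * H) ! k = col C j"
      by (metis in_set_conv_nth)
    then show ?thesis using M by (intro exI[of _ k]) (metis carrier_matD(2) cols_length cols_nth)
  qed
  then obtain k where k: "\<And>j. j < ?s \<Longrightarrow> k j < m \<and> col C j = col (F * H) (k j)" by metis
  define H' where "H' = mat r ?s (\<lambda>(i,j). H $$ (i, k j))"
  have H': "H' \<in> carrier_mat r ?s" by (simp add: H'_def)
  have CH: "C = F * H'"
  proof (rule eq_matI)
    fix i j assume ij: "i < dim_row (F * H')" "j < dim_col (F * H')"
    then have ij': "i < n" "j < ?s" using F H' by auto
    have "C $$ (i,j) = col C j $ i" using C ij' by simp
    also have "\<dots> = (F * H) $$ (i, k j)" using k[OF ij'(2)] ij' F H by simp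
    also have "\<dots> = scalar_prod (row F i) (col H (k j))" using ij' F H k[OF ij'(2)] by simp
    also have "col H (k j) = col H' j" using ij' H k[OF ij'(2)]
      by (intro eq_vecI) (auto simp: H'_def)
    also have "scalar_prod (row F i) \<dots> = (F * H') $$ (i,j)" using ij by simp
    finally show "C $$ (i,j) = (F * H') $$ (i,j)" .
  qed (use C F H' in auto)
  obtain v where v: "v \<in> carrier_vec ?s" "v \<noteq> 0\<^sub>v ?s" "H' *\<^sub>v v = 0\<^sub>v r"
    using wide_mat_kernel[OF H'] less by auto
  have "C *\<^sub>v v = F *\<^sub>v (H' *\<^sub>v v)" unfolding CH using F H' v by simp
  also have "\<dots> = 0\<^sub>v n" using v F by (auto intro!: eq_vecI)
  finally show False using ker v by auto
qed

text \<open>\<open>M\<close> factors through dimension \<open>mrank M\<close>, hence so does the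
  identity of size \<open>r\<close>. The pair \<open>L\<close>, \<open>Y\<close> is a certificate
  for a lower bound on the rank; it is compatible with products, blocks and Kronecker products, so
  the lower bounds on tensor squares rest on it.\<close>

lemma mrank_ge_of_sandwich:
  fixes M :: "'a::field mat"
  assumes M: "M \<in> carrier_mat n m" and L: "L \<in> carrier_mat r n" and Y: "Y \<in> carrier_mat m r"
    and "L * M * Y = 1\<^sub>m r"
  shows "r \<le> mrank M"
proof -
  let ?s = "mrank M"
  obtain C where C: "C \<in> carrier_mat n ?s" 
    and ex: "\<And>j. j < m \<Longrightarrow> \<exists>v\<in>carrier_vec ?s. col M j = C *\<^sub>v v"
    using mrank_basis[OF M] by metis
  obtain v where v: "\<And>j. j < m \<Longrightarrow> v j \<in> carrier_vec ?s \<and> col M j = C *\<^sub>v v j" using ex by metis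
  define H where "H = mat ?s m (\<lambda>(i,j). v j $ i)"
  have H: "H \<in> carrier_mat ?s m" by (simp add: H_def)
  have MH: "M = C * H"
  proof (rule eq_matI)
    fix i j assume ij: "i < dim_row (C * H)" "j < dim_col (C * H)"
    then have ij': "i < n" "j < m" using C H by auto
    have "M $$ (i,j) = col M j $ i" using M ij' by simp
    also have "\<dots> = scalar_prod (row C i) (v j)" using v ij' C by simp
    also have "v j = col H j" using v ij' by (intro eq_vecI) (auto simp: H_def)
    finally show "M $$ (i,j) = (C * H) $$ (i,j)" using ij by simp
  qed (use C M H in auto)
  have "(L * C) * (H * Y) = 1\<^sub>m r"
    using assms(4) L Y C H assoc_mult_mat[of L r n C ?s "H * Y" r]
      assoc_mult_mat[of L r n "C * H" m Y r] assoc_mult_mat[of C n ?s H m Y r]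
    unfolding MH[symmetric] using M by simp
  then show ?thesis using one_mat_factor_le[of "L * C" r ?s "H * Y"] L C H Y by auto
qed

text \<open>Dimension equations as premises let the simplifier reassociate long products without
  instantiating the carriers of the intermediate factors.\<close>

lemma mult_assoc_dim:
  fixes A :: "'a::semiring_0 mat"
  shows "dim_col A = dim_row B \<Longrightarrow> dim_col B = dim_row C \<Longrightarrow> (A * B) * C = A * (B * C)"
  by (rule assoc_mult_mat[of A "dim_row A" "dim_col A" B "dim_col B" C "dim_col C"])
    (auto intro: carrier_matI)

lemma sandwich_append:
  fixes M :: "'a::field mat"
  assumes M: "M \<in> carrier_mat n m"
    and L1: "L1 \<in> carrier_mat r1 n" and Y1: "Y1 \<in> carrier_mat m r1"
    and L2: "L2 \<in> carrier_mat r2 n" and Y2: "Y2 \<in> carrier_mat m r2"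
    and 11: "L1 * M * Y1 = 1\<^sub>m r1" and 12: "L1 * M * Y2 = 0\<^sub>m r1 r2"
    and 21: "L2 * M * Y1 = 0\<^sub>m r2 r1" and 22: "L2 * M * Y2 = 1\<^sub>m r2"
  shows "\<exists>L\<in>carrier_mat (r1 + r2) n. \<exists>Y\<in>carrier_mat m (r1 + r2). L * M * Y = 1\<^sub>m (r1 + r2)"
proof -
  \<comment> \<open>Blocks of width or height zero turn \<open>four_block_mat\<close> into plain
    stacking: \<open>L1\<close> above \<open>L2\<close>, \<open>Y1\<close> beside \<open>Y2\<close>.
    Below, \<open>M\<close> is padded in the same way so that the block product rule
    applies.\<close>
  define L where "L = four_block_mat L1 (0\<^sub>m r1 0) L2 (0\<^sub>m r2 0)"
  define Y where "Y = four_block_mat Y1 Y2 (0\<^sub>m 0 r1) (0\<^sub>m 0 r2)"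
  have M': "M = four_block_mat M (0\<^sub>m n 0) (0\<^sub>m 0 m) (0\<^sub>m 0 0)"
    using M by (intro eq_matI) auto
  have LM: "L * M = four_block_mat (L1 * M) (0\<^sub>m r1 0) (L2 * M) (0\<^sub>m r2 0)"
    unfolding L_def
    by (subst M', subst mult_four_block_mat[of _ r1 n _ 0 _ r2 _ _ m _ 0])
      (use M L1 L2 in auto)
  have "L * M * Y = four_block_mat (1\<^sub>m r1) (0\<^sub>m r1 r2) (0\<^sub>m r2 r1) (1\<^sub>m r2)"
    unfolding LM Y_def
    by (subst mult_four_block_mat[of _ r1 m _ 0 _ r2 _ _ r1 _ r2])
      (use M L1 L2 Y1 Y2 11 12 21 22 in auto)
  moreover have "\<dots> = 1\<^sub>m (r1 + r2)" by simp
  moreover have "L \<in> carrier_mat (r1 + r2) n" "Y \<in> carrier_mat m (r1 + r2)"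
    using four_block_carrier_mat[OF L1, of "0\<^sub>m r2 0" r2 0 "0\<^sub>m r1 0" L2]
      four_block_carrier_mat[OF Y1, of "0\<^sub>m 0 r2" 0 r2 Y2 "0\<^sub>m 0 r1"]
    by (simp_all add: L_def Y_def)
  ultimately show ?thesis by auto
qed

text \<open>A column operation clears the unknown upper right block: subtracting
  \<open>Y1 * X\<close> from \<open>Y2\<close> removes \<open>X\<close> there and leaves the lower
  row unchanged, because \<open>L2 * M * Y1\<close> is zero.\<close>

lemma sandwich_triangular:
  fixes M :: "'a::field mat"
  assumes M: "M \<in> carrier_mat n m"
    and L1: "L1 \<in> carrier_mat r1 n" and Y1: "Y1 \<in> carrier_mat m r1"
    and L2: "L2 \<in> carrier_mat r2 n" and Y2: "Y2 \<in> carrier_mat m r2"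
    and 11: "L1 * M * Y1 = 1\<^sub>m r1"
    and 21: "L2 * M * Y1 = 0\<^sub>m r2 r1" and 22: "L2 * M * Y2 = 1\<^sub>m r2"
  shows "r1 + r2 \<le> mrank M"
proof -
  define X where "X = L1 * M * Y2"
  have X: "X \<in> carrier_mat r1 r2" using L1 M Y2 by (simp add: X_def)
  define Y3 where "Y3 = Y2 - Y1 * X"
  have Y3: "Y3 \<in> carrier_mat m r2" using Y1 X by (auto simp: Y3_def intro!: minus_carrier_mat)
  have *: "L * M * Y3 = L * M * Y2 - (L * M * Y1) * X" if "L \<in> carrier_mat r n" for L r
    using that M Y1 Y2 X unfolding Y3_def
    by (subst mult_minus_distrib_mat[of _ r m _ r2]) (auto simp: assoc_mult_mat[OF mult_carrier_mat[OF that M] Y1 X] simp del: assoc_mult_mat)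
  have "L1 * M * Y3 = 0\<^sub>m r1 r2" unfolding *[OF L1] 11 using X by (simp add: X_def[symmetric])
  moreover have "L2 * M * Y3 = 1\<^sub>m r2" unfolding *[OF L2] 21 22 using X
    by (simp add: left_mult_zero_mat[OF X]) (auto intro!: eq_matI)
  ultimately have "\<exists>L\<in>carrier_mat (r1 + r2) n. \<exists>Y\<in>carrier_mat m (r1 + r2). L * M * Y = 1\<^sub>m (r1 + r2)"
    by (intro sandwich_append[OF M L1 Y1 L2 Y3 11 _ 21])
  then show ?thesis using mrank_ge_of_sandwich[OF M] by auto
qed

text \<open>A certificate of greatest size \<open>r\<close> must reproduce \<open>M\<close> as
  \<open>(M * Y) * (L * M)\<close>, since any nonzero entry of the remainder would extend it by one.
  The factorization then bounds the rank by \<open>r\<close>, so the greatest size is the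
  rank.\<close>

lemma mrank_sandwich:
  fixes M :: "'a::field mat"
  assumes M: "M \<in> carrier_mat n m"
  obtains L Y where "L \<in> carrier_mat (mrank M) n" "Y \<in> carrier_mat m (mrank M)"
    "L * M * Y = 1\<^sub>m (mrank M)" "M = (M * Y) * (L * M)"
proof -
  let ?P = "\<lambda>r. \<exists>L\<in>carrier_mat r n. \<exists>Y\<in>carrier_mat m r. L * M * Y = 1\<^sub>m r"
  have bound: "r \<le> mrank M" if "?P r" for r
    using that mrank_ge_of_sandwich[OF M] by auto
  have "?P 0" by (intro bexI[of _ "0\<^sub>m 0 n"] bexI[of _ "0\<^sub>m m 0"]) (use M in auto)
  then obtain r where r: "?P r" and max: "\<And>s. ?P s \<Longrightarrow> s \<le> r"
    using Nat.ex_has_greatest_nat[of ?P 0 "mrank M"] bound by blast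
  then obtain L Y where L: "L \<in> carrier_mat r n" and Y: "Y \<in> carrier_mat m r"
    and LMY: "L * M * Y = 1\<^sub>m r" by auto
  \<comment> \<open>The remainder is annihilated by \<open>L\<close> from the left and by
    \<open>Y\<close> from the right.\<close>
  define R where "R = M - (M * Y) * (L * M)"
  have R: "R \<in> carrier_mat n m" using M L Y by (auto simp: R_def intro!: minus_carrier_mat)
  have "R = 0\<^sub>m n m"
  proof (rule ccontr)
    assume "R \<noteq> 0\<^sub>m n m"
    then obtain i j where ij: "i < n" "j < m" "R $$ (i,j) \<noteq> 0"
      using R by (metis carrier_matD eq_matI index_zero_mat)
    \<comment> \<open>The row \<open>e\<close> and the column \<open>f\<close> pick the nonzero
      entry of \<open>R\<close> and normalize it: \<open>e * R * f\<close> is the 1 by 1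
      identity.\<close>
    define c where "c = R $$ (i,j)"
    define e where "e = mat 1 n (\<lambda>(_,k). if k = i then inverse c else 0)"
    define f where "f = mat m 1 (\<lambda>(k,_). if k = j then 1 else (0::'a))"
    have e: "e \<in> carrier_mat 1 n" and f: "f \<in> carrier_mat m 1" by (simp_all add: e_def f_def)
    have RY: "R * Y = 0\<^sub>m n r"
    proof -
      have "R * Y = M * Y - (M * Y) * (L * M * Y)"
        using M L Y unfolding R_def
        by (subst minus_mult_distrib_mat[of _ n m _ _ r])
           (auto simp: assoc_mult_mat[of "M * Y" n r "L * M" m Y r])
      then show ?thesis unfolding LMY using M Y by simp
    qed
    have LR: "L * R = 0\<^sub>m r m"
    proof -
      have "L * R = L * M - (L * M * Y) * (L * M)"
        using M L Y unfolding R_def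
        by (subst mult_minus_distrib_mat[of _ r n _ m])
           (auto simp: assoc_mult_mat[of L r n M m Y r] assoc_mult_mat[of L r n "M * Y" r "L * M" m])
      then show ?thesis unfolding LMY using M L by simp
    qed
    \<comment> \<open>Corrections of \<open>e\<close> and \<open>f\<close> that make the mixed
      products with \<open>Y\<close> and \<open>L\<close> vanish; they give
      \<open>L2 * M = e * R\<close> and \<open>M * Y2 = R * f\<close>.\<close>
    define L2 where "L2 = e - (e * M * Y) * L"
    define Y2 where "Y2 = f - Y * (L * M * f)"
    have L2: "L2 \<in> carrier_mat 1 n" unfolding L2_def using e M Y L
      by (intro minus_carrier_mat mult_carrier_mat[of _ 1 r] mult_carrier_mat[of _ 1 m] mult_carrier_mat[of _ 1 n])
    have Y2: "Y2 \<in> carrier_mat m 1" using Y f by (auto simp: Y2_def intro!: minus_carrier_mat)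
    have L2M: "L2 * M = e * R"
    proof -
      have "L2 * M = e * M - (e * M * Y) * L * M"
        unfolding L2_def using e M Y L by (subst minus_mult_distrib_mat[of _ 1 n _ _ m]) auto
      also have "(e * M * Y) * L * M = e * (M * Y * (L * M))" using e M Y L
        by (simp add: mult_assoc_dim del: assoc_mult_mat)
      also have "e * M - \<dots> = e * R" unfolding R_def using e M Y L
        by (subst mult_minus_distrib_mat[of _ 1 n _ m]) auto
      finally show ?thesis .
    qed
    have MY2: "M * Y2 = R * f"
    proof -
      have "M * Y2 = M * f - M * (Y * (L * M * f))"
        unfolding Y2_def using f M Y L by (subst mult_minus_distrib_mat[of _ n m _ 1]) auto
      also have "M * (Y * (L * M * f)) = (M * Y * (L * M)) * f" using f M Y L
        by (simp add: assoc_mult_mat[of _ n r _ m _ 1] assoc_mult_mat[of _ n m _ r _ 1])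
      also have "M * f - \<dots> = R * f" unfolding R_def using f M Y L
        by (subst minus_mult_distrib_mat[of _ n m _ _ 1]) auto
      finally show ?thesis .
    qed
    have "L2 * M * Y = 0\<^sub>m 1 r" unfolding L2M using e R Y RY by simp
    moreover have "L * M * Y2 = 0\<^sub>m r 1"
      using assoc_mult_mat[OF L M Y2] assoc_mult_mat[OF L R f] f by (simp add: MY2 LR)
    moreover have "L2 * M * Y2 = 1\<^sub>m 1"
    proof -
      have "L2 * M * Y2 = e * R * f - (e * R * Y) * (L * M * f)"
        unfolding L2M unfolding Y2_def using e R f Y L M
        by (subst mult_minus_distrib_mat[of _ 1 m _ 1]) (auto simp: mult_assoc_dim simp del: assoc_mult_mat)
      also have "e * R * Y = 0\<^sub>m 1 r" using e R Y RY by simp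
      also have "e * R * f - 0\<^sub>m 1 r * (L * M * f) = e * R * f"
      proof -
        have z: "0\<^sub>m 1 r * (L * M * f) = 0\<^sub>m 1 1" 
          using L M f by (intro left_mult_zero_mat mult_carrier_mat[of _ r m] mult_carrier_mat[of _ r n])
        have s: "A - 0\<^sub>m 1 1 = A" if "A \<in> carrier_mat 1 1" for A :: "'a mat"
          using that by (intro eq_matI) auto
        have "e * R * f \<in> carrier_mat 1 1"
          using e R f by (intro mult_carrier_mat[of _ 1 m] mult_carrier_mat[of _ 1 n])
        then show ?thesis unfolding z by (rule s)
      qed
      also have "\<dots> = 1\<^sub>m 1"
      proof (rule eq_matI)
        fix a b assume "a < dim_row (1\<^sub>m 1 :: 'a mat)" "b < dim_col (1\<^sub>m 1 :: 'a mat)"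
        then have [simp]: "a = 0" "b = 0" by auto
        have eR: "(e * R) $$ (0, k) = inverse c * R $$ (i, k)" if "k < m" for k
        proof -
          have "(e * R) $$ (0, k) = (\<Sum>l = 0..<n. (if l = i then inverse c else 0) * R $$ (l, k))"
            using that R by (simp add: scalar_prod_def e_def)
          also have "\<dots> = (\<Sum>l = 0..<n. if l = i then inverse c * R $$ (i, k) else 0)"
            by (intro sum.cong) auto
          finally show ?thesis using ij by simp
        qed
        have "(P * f) $$ (0, 0) = (\<Sum>k = 0..<m. P $$ (0, k) * (if k = j then 1 else 0))"
          if "P \<in> carrier_mat 1 m" for P
          using that f by (simp add: scalar_prod_def) (simp add: f_def)
        from this[of "e * R"] have "(e * R * f) $$ (0, 0) = (\<Sum>k = 0..<m. (e * R) $$ (0, k) * (if k = j then 1 else 0))"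
          using mult_carrier_mat[OF e R] by blast
        also have "\<dots> = (\<Sum>k = 0..<m. inverse c * R $$ (i, k) * (if k = j then 1 else 0))"
          using eR by (intro sum.cong) auto
        also have "\<dots> = (\<Sum>k = 0..<m. if k = j then inverse c * R $$ (i, j) else 0)"
          by (intro sum.cong) auto
        also have "\<dots> = 1" using ij by (simp add: c_def)
        finally show "(e * R * f) $$ (a, b) = 1\<^sub>m 1 $$ (a, b)" by simp
      qed (use e f in simp_all)
      finally show ?thesis .
    qed
    ultimately have "?P (r + 1)" by (intro sandwich_append[OF M L Y L2 Y2 LMY])
    with max show False by fastforce
  qed
  then have eq: "M = (M * Y) * (L * M)"
  proof -
    have "M $$ (i,j) = ((M * Y) * (L * M)) $$ (i,j)" if "i < n" "j < m" for i j
    proof -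
      have "R $$ (i,j) = 0" using \<open>R = 0\<^sub>m n m\<close> that by simp
      then show ?thesis unfolding R_def using that M L Y by simp
    qed
    then show ?thesis using M L Y by (intro eq_matI) auto
  qed
  have "mrank M \<le> r" 
    using mrank_le_of_factor[of "M * Y" n r "L * M" m] M L Y unfolding eq[symmetric] by simp
  then have "r = mrank M" using bound[OF r] by simp
  then show thesis using that L Y LMY eq by blast
qed

lemma mrank_mult_le_left:
  fixes A :: "'a::field mat"
  assumes "A \<in> carrier_mat n m" "B \<in> carrier_mat m l"
  shows "mrank (A * B) \<le> mrank A"
proof -
  obtain L Y where LY: "L \<in> carrier_mat (mrank A) n" "Y \<in> carrier_mat m (mrank A)"
    and eq: "A = (A * Y) * (L * A)" using mrank_sandwich[OF assms(1)] by metis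
  have "(A * Y) * (L * A) * B = (A * Y) * (L * A * B)" 
    using LY assms by (intro assoc_mult_mat[of "A * Y" n "mrank A" "L * A" m B l]) auto
  then have "A * B = (A * Y) * (L * A * B)" unfolding eq[symmetric] .
  then show ?thesis using mrank_le_of_factor[of "A * Y" n "mrank A" "L * A * B" l] LY assms by simp
qed

lemma mrank_mult_le_right:
  fixes A :: "'a::field mat"
  assumes "A \<in> carrier_mat n m" "B \<in> carrier_mat m l"
  shows "mrank (A * B) \<le> mrank B"
proof -
  obtain L Y where LY: "L \<in> carrier_mat (mrank B) m" "Y \<in> carrier_mat l (mrank B)"
    and eq: "B = (B * Y) * (L * B)" using mrank_sandwich[OF assms(2)] by metis
  have "A * (B * Y) * (L * B) = A * ((B * Y) * (L * B))" 
    using LY assms by (intro assoc_mult_mat[of A n m "B * Y" "mrank B" "L * B" l]) auto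
  then have "A * B = (A * (B * Y)) * (L * B)" unfolding eq[symmetric] by simp
  then show ?thesis using mrank_le_of_factor[of "A * (B * Y)" n "mrank B" "L * B" l] LY assms by simp
qed

lemma mrank_add_le:
  fixes A :: "'a::field mat"
  assumes "A \<in> carrier_mat n m" "B \<in> carrier_mat n m"
  shows "mrank (A + B) \<le> mrank A + mrank B"
  using vec_space.rank_subadditive[OF assms] assms by (simp add: mrank_def)

lemma mrank_le_dim_row:
  fixes A :: "'a::field mat"
  assumes "A \<in> carrier_mat n m"
  shows "mrank A \<le> n"
  using mrank_le_of_factor[of "1\<^sub>m n" n n A m] assms by simp

lemma mrank_smult_le:
  fixes A :: "'a::field mat"
  assumes "A \<in> carrier_mat n m"
  shows "mrank (c \<cdot>\<^sub>m A) \<le> mrank A"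
proof -
  have "c \<cdot>\<^sub>m A = (c \<cdot>\<^sub>m 1\<^sub>m n) * A" using assms
    by (subst mult_smult_assoc_mat[of _ n n _ m]) auto
  then show ?thesis using mrank_mult_le_right[of "c \<cdot>\<^sub>m 1\<^sub>m n" n n A m] assms by simp
qed

lemma mrank_one: "mrank (1\<^sub>m n :: 'a::field mat) = n"
  using mrank_ge_of_sandwich[of "1\<^sub>m n :: 'a mat" n n "1\<^sub>m n" n "1\<^sub>m n"] mrank_le_dim_row[of "1\<^sub>m n :: 'a mat" n n]
  by (simp add: le_antisym)

section \<open>Kronecker products\<close>

text \<open>In this index order \<open>kron T A\<close> is the block matrix with blocks
  \<open>T $$ (i,j)\<close> times \<open>A\<close>, so a triangular \<open>T\<close> gives a block
  triangular product.\<close>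

definition kron :: "'a::semiring_0 mat \<Rightarrow> 'a mat \<Rightarrow> 'a mat" where
  "kron A B = mat (dim_row A * dim_row B) (dim_col A * dim_col B)
    (\<lambda>(i,j). A $$ (i div dim_row B, j div dim_col B) * B $$ (i mod dim_row B, j mod dim_col B))"

lemma kron_carrier [simp, intro]:
  "A \<in> carrier_mat n m \<Longrightarrow> B \<in> carrier_mat n' m' \<Longrightarrow> kron A B \<in> carrier_mat (n * n') (m * m')"
  by (auto simp: kron_def)

lemma kron_dim [simp]:
  "dim_row (kron A B) = dim_row A * dim_row B" "dim_col (kron A B) = dim_col A * dim_col B"
  by (auto simp: kron_def)

lemma div_mod_bounds:
  fixes i :: nat
  assumes "i < a * b"
  shows "i div b < a" "i mod b < b" "0 < b"
proof -
  show "0 < b" using assms by (cases b) auto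
  then show "i div b < a" "i mod b < b" using assms by (auto simp: less_mult_imp_div_less)
qed

lemma kron_index:
  "i < dim_row A * dim_row B \<Longrightarrow> j < dim_col A * dim_col B \<Longrightarrow>
    kron A B $$ (i,j) = A $$ (i div dim_row B, j div dim_col B) * B $$ (i mod dim_row B, j mod dim_col B)"
  by (simp add: kron_def)

lemma sum_div_mod:
  fixes m n :: nat and f :: "nat \<Rightarrow> nat \<Rightarrow> 'a::comm_monoid_add"
  shows "(\<Sum>k = 0..<m * n. f (k div n) (k mod n)) = (\<Sum>i = 0..<m. \<Sum>j = 0..<n. f i j)"
proof (induction m)
  case (Suc m)
  have "(\<Sum>k = 0..<Suc m * n. f (k div n) (k mod n)) 
      = (\<Sum>k = 0..<m * n. f (k div n) (k mod n)) + (\<Sum>k = m * n..<m * n + n. f (k div n) (k mod n))"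
    by (subst sum.atLeastLessThan_concat) (auto simp: add.commute)
  also have "(\<Sum>k = m * n..<m * n + n. f (k div n) (k mod n)) = (\<Sum>j = 0..<n. f m j)"
    using sum.shift_bounds_nat_ivl[of "\<lambda>k. f (k div n) (k mod n)" 0 "m * n" n]
    by (simp add: add.commute)
  finally show ?case using Suc by simp
qed simp

lemma kron_mult:
  fixes A :: "'a::comm_semiring_0 mat"
  assumes A: "A \<in> carrier_mat n m" and C: "C \<in> carrier_mat m l"
    and B: "B \<in> carrier_mat n' m'" and D: "D \<in> carrier_mat m' l'"
  shows "kron A B * kron C D = kron (A * C) (B * D)"
proof (rule eq_matI)
  fix i j assume "i < dim_row (kron (A * C) (B * D))" "j < dim_col (kron (A * C) (B * D))"
  then have i: "i < n * n'" and j: "j < l * l'" using assms by auto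
  note ib = div_mod_bounds[OF i] and jb = div_mod_bounds[OF j]
  have "(kron A B * kron C D) $$ (i,j) = (\<Sum>k = 0..<m * m'. kron A B $$ (i,k) * kron C D $$ (k,j))"
    using i j assms by (simp add: scalar_prod_def)
  also have "\<dots> = (\<Sum>k = 0..<m * m'. A $$ (i div n', k div m') * C $$ (k div m', j div l') *
      (B $$ (i mod n', k mod m') * D $$ (k mod m', j mod l')))"
    using i j assms by (intro sum.cong) (auto simp: kron_index mult_ac)
  also have "\<dots> = (\<Sum>p = 0..<m. \<Sum>q = 0..<m'. A $$ (i div n', p) * C $$ (p, j div l') *
      (B $$ (i mod n', q) * D $$ (q, j mod l')))"
    by (rule sum_div_mod)
  also have "\<dots> = (\<Sum>p = 0..<m. A $$ (i div n', p) * C $$ (p, j div l')) *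
      (\<Sum>q = 0..<m'. B $$ (i mod n', q) * D $$ (q, j mod l'))"
    by (simp add: sum_product)
  also have "\<dots> = kron (A * C) (B * D) $$ (i,j)"
    using i j ib jb assms by (simp add: kron_index scalar_prod_def)
  finally show "(kron A B * kron C D) $$ (i,j) = kron (A * C) (B * D) $$ (i,j)" .
qed (use assms in auto)

lemma kron_one: "kron (1\<^sub>m n) (1\<^sub>m m) = (1\<^sub>m (n * m) :: 'a::semiring_1 mat)"
proof (rule eq_matI)
  fix i j assume "i < dim_row (1\<^sub>m (n * m) :: 'a mat)" "j < dim_col (1\<^sub>m (n * m) :: 'a mat)"
  then have i: "i < n * m" and j: "j < n * m" by auto
  have "i = j \<longleftrightarrow> i div m = j div m \<and> i mod m = j mod m"
    by (metis div_mult_mod_eq)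
  then show "kron (1\<^sub>m n) (1\<^sub>m m) $$ (i,j) = (1\<^sub>m (n * m) :: 'a mat) $$ (i,j)"
    using i j div_mod_bounds[OF i] div_mod_bounds[OF j] by (auto simp: kron_index)
qed auto

lemma kron_zero_left: "B \<in> carrier_mat n' m' \<Longrightarrow> kron (0\<^sub>m n m) B = 0\<^sub>m (n * n') (m * m')"
  by (intro eq_matI) (auto simp: kron_index less_mult_imp_div_less)

lemma kron_minus_left:
  fixes A :: "'a::ring mat"
  shows "A \<in> carrier_mat n m \<Longrightarrow> A' \<in> carrier_mat n m \<Longrightarrow> kron (A - A') B = kron A B - kron A' B"
  by (intro eq_matI) (auto simp: kron_index less_mult_imp_div_less left_diff_distrib)

lemma kron_minus_right:
  fixes B :: "'a::ring mat"
  shows "B \<in> carrier_mat n m \<Longrightarrow> B' \<in> carrier_mat n m \<Longrightarrow> kron A (B - B') = kron A B - kron A B'"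
  by (intro eq_matI) (auto simp: kron_index div_mod_bounds right_diff_distrib)

lemma kron_smult_left: 
  fixes A :: "'a::comm_semiring_0 mat"
  shows "kron (c \<cdot>\<^sub>m A) B = c \<cdot>\<^sub>m kron A B"
  by (intro eq_matI) (auto simp: kron_index less_mult_imp_div_less mult_ac)

lemma kron_smult_right: 
  fixes A :: "'a::comm_semiring_0 mat"
  shows "kron A (c \<cdot>\<^sub>m B) = c \<cdot>\<^sub>m kron A B"
  by (intro eq_matI) (auto simp: kron_index div_mod_bounds mult_ac)

text \<open>A factorization of \<open>A\<close> through dimension \<open>mrank A\<close>, tensored
  with \<open>B\<close>, gives the bound. The rank of \<open>B\<close> is estimated by its width
  only, which suffices for the Lipschitz estimate of tensor squaring.\<close>

lemma mrank_kron_le_left: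
  fixes A :: "'a::field mat"
  assumes A: "A \<in> carrier_mat n m" and B: "B \<in> carrier_mat n' m'"
  shows "mrank (kron A B) \<le> mrank A * m'"
proof -
  obtain L Y where LY: "L \<in> carrier_mat (mrank A) n" "Y \<in> carrier_mat m (mrank A)"
    and eq: "A = (A * Y) * (L * A)" using mrank_sandwich[OF A] by metis
  have "kron (A * Y) B * kron (L * A) (1\<^sub>m m') = kron ((A * Y) * (L * A)) (B * 1\<^sub>m m')"
    using LY A B by (intro kron_mult[of _ n "mrank A" _ m _ n' m' _ m']) auto
  then have "kron A B = kron (A * Y) B * kron (L * A) (1\<^sub>m m')"
    using B unfolding eq[symmetric] by simp
  then show ?thesis 
    using mrank_le_of_factor[of "kron (A * Y) B" "n * n'" "mrank A * m'" "kron (L * A) (1\<^sub>m m')" "m * m'"] 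
      LY A B by simp
qed

lemma mrank_kron_le_right:
  fixes A :: "'a::field mat"
  assumes A: "A \<in> carrier_mat n m" and B: "B \<in> carrier_mat n' m'"
  shows "mrank (kron A B) \<le> m * mrank B"
proof -
  obtain L Y where LY: "L \<in> carrier_mat (mrank B) n'" "Y \<in> carrier_mat m' (mrank B)"
    and eq: "B = (B * Y) * (L * B)" using mrank_sandwich[OF B] by metis
  have "kron A (B * Y) * kron (1\<^sub>m m) (L * B) = kron (A * 1\<^sub>m m) ((B * Y) * (L * B))"
    using LY A B by (intro kron_mult[of _ n m _ m _ n' "mrank B" _ m']) auto
  then have "kron A B = kron A (B * Y) * kron (1\<^sub>m m) (L * B)"
    using A unfolding eq[symmetric] by simp
  then show ?thesis 
    using mrank_le_of_factor[of "kron A (B * Y)" "n * n'" "m * mrank B" "kron (1\<^sub>m m) (L * B)" "m * m'"] 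
      LY A B by simp
qed

section \<open>Kernels and block triangular matrices\<close>

text \<open>Rank-nullity in matrix form: the columns of \<open>U\<close> lie in the kernel and the
  left inverse \<open>V\<close> certifies their independence. They are taken from the image of
  \<open>E = 1 - Y * (L * M)\<close>, for which \<open>M * E = 0\<close>, and whose rank is at least
  \<open>n - mrank M\<close> by subadditivity.\<close>

lemma kernel_basis:
  fixes M :: "'a::field mat"
  assumes M: "M \<in> carrier_mat n n"
  obtains U V where "U \<in> carrier_mat n (n - mrank M)" "V \<in> carrier_mat (n - mrank M) n"
    "V * U = 1\<^sub>m (n - mrank M)" "M * U = 0\<^sub>m n (n - mrank M)"
proof -
  let ?r = "mrank M"
  obtain L Y where L: "L \<in> carrier_mat ?r n" and Y: "Y \<in> carrier_mat n ?r"
    and eq: "M = (M * Y) * (L * M)" using mrank_sandwich[OF M] by metis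
  define E where "E = 1\<^sub>m n - Y * (L * M)"
  have YLM: "Y * (L * M) \<in> carrier_mat n n" using L Y M by simp
  have E: "E \<in> carrier_mat n n" unfolding E_def using YLM by (rule minus_carrier_mat)
  have "M * (Y * (L * M)) = M"
    using eq assoc_mult_mat[OF M Y mult_carrier_mat[OF L M]] by metis
  then have ME: "M * E = 0\<^sub>m n n"
    unfolding E_def using M YLM mult_minus_distrib_mat[OF M one_carrier_mat YLM] by simp
  have "1\<^sub>m n = E + Y * (L * M)" using YLM unfolding E_def by (intro eq_matI) auto
  then have "n \<le> mrank E + mrank (Y * (L * M))"
    using mrank_one[of n, where ?'a = 'a] mrank_add_le[OF E YLM] by simp
  then have le: "n - ?r \<le> mrank E" using mrank_le_of_factor[OF Y mult_carrier_mat[OF L M]] by simp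
  obtain L' Y' where L': "L' \<in> carrier_mat (mrank E) n" and Y': "Y' \<in> carrier_mat n (mrank E)"
    and 1: "L' * E * Y' = 1\<^sub>m (mrank E)" using mrank_sandwich[OF E] by metis
  let ?k = "n - ?r" and ?s = "mrank E"
  \<comment> \<open>Only \<open>n - mrank M \<le> mrank E\<close> is known at this point, so the
    certificate of \<open>E\<close> is truncated to the wanted size.\<close>
  define C where "C = mat ?k ?s (\<lambda>(i,j). if i = j then 1 else (0::'a))"
  define D where "D = mat ?s ?k (\<lambda>(i,j). if i = j then 1 else (0::'a))"
  have C: "C \<in> carrier_mat ?k ?s" and D: "D \<in> carrier_mat ?s ?k" by (simp_all add: C_def D_def)
  have CD: "C * D = 1\<^sub>m ?k"
  proof (rule eq_matI)
    fix i j assume "i < dim_row (1\<^sub>m ?k :: 'a mat)" "j < dim_col (1\<^sub>m ?k :: 'a mat)"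
    then have ij: "i < ?k" "j < ?k" by auto
    then have "(C * D) $$ (i,j) = (\<Sum>l = 0..<?s. (if i = l then 1 else 0) * (if l = j then 1 else 0))"
      by (simp add: C_def D_def scalar_prod_def)
    also have "\<dots> = (\<Sum>l = 0..<?s. if l = i then (if i = j then 1 else 0) else 0)"
      by (intro sum.cong) auto
    finally show "(C * D) $$ (i,j) = 1\<^sub>m ?k $$ (i,j)" using ij le by simp
  qed (simp_all add: C_def D_def)
  show thesis
  proof
    show "E * (Y' * D) \<in> carrier_mat n ?k" using E Y' D by simp
    show "C * L' \<in> carrier_mat ?k n" using C L' by simp
    have "C * L' * (E * (Y' * D)) = C * (L' * E * Y') * D"
      using C L' E Y' D by (simp add: mult_assoc_dim del: assoc_mult_mat)
    then show "C * L' * (E * (Y' * D)) = 1\<^sub>m ?k" unfolding 1 using C CD by simp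
    have "M * (E * (Y' * D)) = M * E * (Y' * D)"
      using M E Y' D by (simp add: mult_assoc_dim del: assoc_mult_mat)
    then show "M * (E * (Y' * D)) = 0\<^sub>m n ?k" unfolding ME using Y' D by simp
  qed
qed

text \<open>Certificates of the diagonal blocks, padded with zeros, form a triangular pair: the zero
  block below the diagonal kills \<open>P2 * ?M * Q1\<close>, and \<open>B\<close> only enters the
  block that \<open>sandwich_triangular\<close> leaves free.\<close>

lemma mrank_four_block_triangular:
  fixes A :: "'a::field mat"
  assumes A: "A \<in> carrier_mat n n" and B: "B \<in> carrier_mat n m" and D: "D \<in> carrier_mat m m"
  shows "mrank A + mrank D \<le> mrank (four_block_mat A B (0\<^sub>m m n) D)"
proof -
  let ?M = "four_block_mat A B (0\<^sub>m m n) D"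
  obtain L1 Y1 where 1: "L1 \<in> carrier_mat (mrank A) n" "Y1 \<in> carrier_mat n (mrank A)"
    "L1 * A * Y1 = 1\<^sub>m (mrank A)" using mrank_sandwich[OF A] by metis
  obtain L2 Y2 where 2: "L2 \<in> carrier_mat (mrank D) m" "Y2 \<in> carrier_mat m (mrank D)"
    "L2 * D * Y2 = 1\<^sub>m (mrank D)" using mrank_sandwich[OF D] by metis
  define P1 where "P1 = four_block_mat L1 (0\<^sub>m (mrank A) m) (0\<^sub>m 0 n) (0\<^sub>m 0 m)"
  define Q1 where "Q1 = four_block_mat Y1 (0\<^sub>m n 0) (0\<^sub>m m (mrank A)) (0\<^sub>m m 0)"
  define P2 where "P2 = four_block_mat (0\<^sub>m (mrank D) n) L2 (0\<^sub>m 0 n) (0\<^sub>m 0 m)"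
  define Q2 where "Q2 = four_block_mat (0\<^sub>m n (mrank D)) (0\<^sub>m n 0) Y2 (0\<^sub>m m 0)"
  have carr: "P1 \<in> carrier_mat (mrank A) (n + m)" "Q1 \<in> carrier_mat (n + m) (mrank A)"
    "P2 \<in> carrier_mat (mrank D) (n + m)" "Q2 \<in> carrier_mat (n + m) (mrank D)"
    unfolding P1_def Q1_def P2_def Q2_def using 1 2 by auto
  have P1M: "P1 * ?M = four_block_mat (L1 * A) (L1 * B) (0\<^sub>m 0 n) (0\<^sub>m 0 m)"
    unfolding P1_def using 1 A B D
    by (subst mult_four_block_mat[of _ "mrank A" n _ m _ 0 _ _ n _ m]) auto
  have P2M: "P2 * ?M = four_block_mat (0\<^sub>m (mrank D) n) (L2 * D) (0\<^sub>m 0 n) (0\<^sub>m 0 m)"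
    unfolding P2_def using 2 A B D
    by (subst mult_four_block_mat[of _ "mrank D" n _ m _ 0 _ _ n _ m]) auto
  have drop: "four_block_mat X (0\<^sub>m k 0) (0\<^sub>m 0 l) (0\<^sub>m 0 0) = X" if "X \<in> carrier_mat k l" for X :: "'a mat" and k l
    using that by (intro eq_matI) auto
  have "P1 * ?M * Q1 = 1\<^sub>m (mrank A)"
    unfolding P1M unfolding Q1_def using 1 A B
    by (subst mult_four_block_mat[of _ "mrank A" n _ m _ 0 _ _ "mrank A" _ 0]) (auto simp: drop)
  moreover have "P2 * ?M * Q1 = 0\<^sub>m (mrank D) (mrank A)"
    unfolding P2M unfolding Q1_def using 1 2 D
    by (subst mult_four_block_mat[of _ "mrank D" n _ m _ 0 _ _ "mrank A" _ 0]) (auto simp: drop)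
  moreover have "P2 * ?M * Q2 = 1\<^sub>m (mrank D)"
    unfolding P2M unfolding Q2_def using 2 D
    by (subst mult_four_block_mat[of _ "mrank D" n _ m _ 0 _ _ "mrank D" _ 0]) (auto simp: drop)
  ultimately show ?thesis
    using A B D by (intro sandwich_triangular[OF _ carr]) auto
qed

text \<open>\<open>kron T A - c\<close> is block upper triangular with diagonal blocks
  \<open>T $$ (i,i)\<close> times \<open>A\<close> minus \<open>c\<close>, and the ranks of diagonal
  blocks add up to a lower bound. The induction splits off the first row and column of
  \<open>T\<close>.\<close>

lemma mrank_kron_upper_triangular:
  fixes A :: "'a::field mat"
  assumes A: "A \<in> carrier_mat n n"
    and "T \<in> carrier_mat m m" "upper_triangular T"
    and "\<And>i. i < m \<Longrightarrow> s \<le> mrank (T $$ (i,i) \<cdot>\<^sub>m A - c \<cdot>\<^sub>m 1\<^sub>m n)"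
  shows "m * s \<le> mrank (kron T A - c \<cdot>\<^sub>m 1\<^sub>m (m * n))"
  using assms(2-4)
proof (induction m arbitrary: T)
  case (Suc m)
  define T' where "T' = mat m m (\<lambda>(i,j). T $$ (Suc i, Suc j))"
  define X where "X = mat n (m * n) (\<lambda>(i,j). T $$ (0, Suc (j div n)) * A $$ (i, j mod n))"
  have T': "T' \<in> carrier_mat m m" and X: "X \<in> carrier_mat n (m * n)" by (simp_all add: T'_def X_def)
  have "upper_triangular T'" using Suc.prems(1,2) unfolding upper_triangular_def T'_def by auto
  moreover have "s \<le> mrank (T' $$ (i,i) \<cdot>\<^sub>m A - c \<cdot>\<^sub>m 1\<^sub>m n)" if "i < m" for i
    using Suc.prems(3)[of "Suc i"] that by (simp add: T'_def)
  ultimately have IH: "m * s \<le> mrank (kron T' A - c \<cdot>\<^sub>m 1\<^sub>m (m * n))"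
    using Suc.IH[OF T'] by simp
  have eq: "kron T A - c \<cdot>\<^sub>m 1\<^sub>m (Suc m * n) = four_block_mat (T $$ (0,0) \<cdot>\<^sub>m A - c \<cdot>\<^sub>m 1\<^sub>m n) X
      (0\<^sub>m (m * n) n) (kron T' A - c \<cdot>\<^sub>m 1\<^sub>m (m * n))" (is "_ = ?R")
  proof (rule eq_matI)
    fix i j assume "i < dim_row ?R" "j < dim_col ?R"
    then have ij: "i < n + m * n" "j < n + m * n" using A T' by auto
    then have n: "0 < n" by (cases n) auto
    \<comment> \<open>Beyond the first block, subtracting \<open>n\<close> lowers the block number
      by one and keeps the offset within the block.\<close>
    have sh: "k div n = Suc ((k - n) div n)" "k mod n = (k - n) mod n" if "n \<le> k" for k
      using that n by (simp_all add: le_div_geq le_mod_geq)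
    have lt: "(k - n) div n < m" "(k - n) mod n < n" if "n \<le> k" "k < n + m * n" for k
      using that n by (auto simp: less_mult_imp_div_less)
    show "(kron T A - c \<cdot>\<^sub>m 1\<^sub>m (Suc m * n)) $$ (i,j) = ?R $$ (i,j)"
    proof (cases "i < n"; cases "j < n")
      assume "i < n" "j < n"
      then show ?thesis using A Suc.prems(1) ij T' by (auto simp: kron_index)
    next
      assume "i < n" "\<not> j < n"
      then show ?thesis using A Suc.prems(1) ij T' lt[of j] by (auto simp: kron_index sh[of j] X_def)
    next
      assume "\<not> i < n" "j < n"
      moreover from this have "T $$ (Suc ((i - n) div n), 0) = 0"
        using Suc.prems(1,2) lt[of i] ij by auto
      ultimately show ?thesis using A Suc.prems(1) ij T' by (auto simp: kron_index sh[of i])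
    next
      assume "\<not> i < n" "\<not> j < n"
      then show ?thesis using A Suc.prems(1) ij T' lt[of i] lt[of j]
        by (auto simp: kron_index sh[of i] sh[of j] T'_def)
    qed
  qed (use A T' Suc.prems(1) in auto)
  have "s + m * s \<le> mrank (T $$ (0,0) \<cdot>\<^sub>m A - c \<cdot>\<^sub>m 1\<^sub>m n) + mrank (kron T' A - c \<cdot>\<^sub>m 1\<^sub>m (m * n))"
    using IH Suc.prems(3)[of 0] by simp
  also have "\<dots> \<le> mrank ?R"
    using A T' X by (intro mrank_four_block_triangular minus_carrier_mat) auto
  finally show ?case unfolding eq by simp
qed simp

section \<open>Tensor squares of matrices close to a scalar\<close>

lemma mat_minus_eqD:
  fixes A :: "'a::ring mat"
  assumes "A \<in> carrier_mat n m" "B \<in> carrier_mat n m" "A - B = 0\<^sub>m n m"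
  shows "A = B"
proof (rule eq_matI)
  fix i j assume "i < dim_row B" "j < dim_col B"
  then have ij: "i < n" "j < m" using assms by auto
  have "(A - B) $$ (i,j) = 0" using ij assms(3) by simp
  then show "A $$ (i,j) = B $$ (i,j)" using ij assms(1,2) by simp
qed (use assms in auto)

lemma minus_scalar_mult:
  fixes A :: "'a::comm_ring_1 mat"
  assumes "A \<in> carrier_mat n n" "U \<in> carrier_mat n k"
  shows "(A - a \<cdot>\<^sub>m 1\<^sub>m n) * U = A * U - a \<cdot>\<^sub>m U"
  using assms by (subst minus_mult_distrib_mat[of _ n n _ _ k]) (auto simp: mult_smult_assoc_mat[of _ n n _ k])

lemma eigen_kernel:
  fixes A :: "'a::field mat"
  assumes A: "A \<in> carrier_mat n n" and U: "U \<in> carrier_mat n k"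
    and "(A - a \<cdot>\<^sub>m 1\<^sub>m n) * U = 0\<^sub>m n k"
  shows "A * U = a \<cdot>\<^sub>m U"
  by (rule mat_minus_eqD[of _ n k]) (use assms minus_scalar_mult[OF A U] in auto)

lemma sandwich_smult:
  fixes M :: "'a::field mat"
  assumes "M \<in> carrier_mat n m" "L \<in> carrier_mat r n" "Y \<in> carrier_mat m r'"
  shows "(c \<cdot>\<^sub>m L) * M * Y = c \<cdot>\<^sub>m (L * (M * Y))"
  using assms by (simp add: mult_smult_assoc_mat[of _ r n _ m] mult_smult_assoc_mat[of _ r m _ r']
      mult_assoc_dim del: assoc_mult_mat)

text \<open>On the tensor square of the eigenspace of \<open>A\<close> at \<open>a\<close>, the matrix \<open>A \<otimes> A - c\<close> is the
  scalar \<open>a\<^sup>2 - c\<close>.\<close>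

lemma mrank_kron_square_off_diagonal:
  fixes A :: "'a::field mat"
  assumes A: "A \<in> carrier_mat n n" and c: "c \<noteq> a * a"
  defines "k \<equiv> n - mrank (A - a \<cdot>\<^sub>m 1\<^sub>m n)"
  shows "k * k \<le> mrank (kron A A - c \<cdot>\<^sub>m 1\<^sub>m (n * n))"
proof -
  have "A - a \<cdot>\<^sub>m 1\<^sub>m n \<in> carrier_mat n n" using A by (intro minus_carrier_mat) simp
  then obtain U V where U: "U \<in> carrier_mat n k" and V: "V \<in> carrier_mat k n"
    and VU: "V * U = 1\<^sub>m k" and AU0: "(A - a \<cdot>\<^sub>m 1\<^sub>m n) * U = 0\<^sub>m n k"
    unfolding k_def by (rule kernel_basis)
  have AU: "A * U = a \<cdot>\<^sub>m U" by (rule eigen_kernel[OF A U AU0])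
  let ?M = "kron A A - c \<cdot>\<^sub>m 1\<^sub>m (n * n)"
  have M: "?M \<in> carrier_mat (n * n) (n * n)" using A by (intro minus_carrier_mat) simp
  have UU: "kron U U \<in> carrier_mat (n * n) (k * k)" and VV: "kron V V \<in> carrier_mat (k * k) (n * n)"
    using U V by auto
  have "?M * kron U U = kron (A * U) (A * U) - c \<cdot>\<^sub>m kron U U"
    using A U by (subst minus_scalar_mult[OF _ UU]) (auto simp: kron_mult[of _ n n _ k _ n n _ k])
  also have "\<dots> = (a * a - c) \<cdot>\<^sub>m kron U U"
    unfolding AU kron_smult_left kron_smult_right
    by (intro eq_matI) (auto simp: algebra_simps)
  finally have MU: "?M * kron U U = (a * a - c) \<cdot>\<^sub>m kron U U" .
  have "kron V V * kron U U = 1\<^sub>m (k * k)"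
    using U V VU by (simp add: kron_mult[of _ k n _ k _ k n _ k] kron_one)
  then have "(inverse (a * a - c) \<cdot>\<^sub>m kron V V) * ?M * kron U U = 1\<^sub>m (k * k)"
    unfolding sandwich_smult[OF M VV UU] MU using UU VV c
    by (simp add: mult_smult_distrib[of _ "k * k" "n * n" _ "k * k"])
       (auto intro!: eq_matI)
  then show ?thesis using M UU VV
    by (intro mrank_ge_of_sandwich[of _ "n * n" "n * n" "inverse (a * a - c) \<cdot>\<^sub>m kron V V" _ "kron U U"]) auto
qed

text \<open>For an eigenvector u, the image of u \<otimes> y under A \<otimes> A is a u \<otimes> A
  y, so subtracting a^2 leaves a u \<otimes> (A - a) y. The columns of \<open>U\<close> need not
  span the whole eigenspace; the estimate below also uses a smaller family.\<close>

lemma kron_square_minus_mult_left: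
  fixes A :: "'a::field mat"
  assumes A: "A \<in> carrier_mat n n" and U: "U \<in> carrier_mat n k" and Y: "Y \<in> carrier_mat n l"
    and AU: "A * U = a \<cdot>\<^sub>m U"
  shows "(kron A A - (a * a) \<cdot>\<^sub>m 1\<^sub>m (n * n)) * kron U Y = a \<cdot>\<^sub>m kron U ((A - a \<cdot>\<^sub>m 1\<^sub>m n) * Y)"
    and "(kron A A - (a * a) \<cdot>\<^sub>m 1\<^sub>m (n * n)) * kron Y U = a \<cdot>\<^sub>m kron ((A - a \<cdot>\<^sub>m 1\<^sub>m n) * Y) U"
proof -
  have UY: "kron U Y \<in> carrier_mat (n * n) (k * l)" "kron Y U \<in> carrier_mat (n * n) (l * k)"
    using U Y by auto
  have AY: "A * Y \<in> carrier_mat n l" using A Y by simp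
  show "(kron A A - (a * a) \<cdot>\<^sub>m 1\<^sub>m (n * n)) * kron U Y = a \<cdot>\<^sub>m kron U ((A - a \<cdot>\<^sub>m 1\<^sub>m n) * Y)"
    unfolding minus_scalar_mult[OF A Y]
    using A U Y AY by (subst minus_scalar_mult[OF _ UY(1)])
      (auto simp: kron_mult[of _ n n _ k _ n n _ l] AU kron_smult_left kron_smult_right
        kron_minus_right[of _ n l] algebra_simps intro!: eq_matI)
  show "(kron A A - (a * a) \<cdot>\<^sub>m 1\<^sub>m (n * n)) * kron Y U = a \<cdot>\<^sub>m kron ((A - a \<cdot>\<^sub>m 1\<^sub>m n) * Y) U"
    unfolding minus_scalar_mult[OF A Y]
    using A U Y AY by (subst minus_scalar_mult[OF _ UY(2)])
      (auto simp: kron_mult[of _ n n _ l _ n n _ k] AU kron_smult_left kron_smult_right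
        kron_minus_left[of _ n l] algebra_simps intro!: eq_matI)
qed

text \<open>With \<open>N = A - a\<close>, the matrix \<open>A \<otimes> A - a\<^sup>2\<close> maps \<open>ker N \<otimes> V\<close> onto \<open>ker N \<otimes> im N\<close> and
  \<open>V \<otimes> ker N\<close> onto \<open>im N \<otimes> ker N\<close>. If \<open>U'\<close> is a complement of \<open>ker N \<inter> im N\<close> in \<open>ker N\<close>, the
  subspaces \<open>U' \<otimes> im N\<close> and \<open>im N \<otimes> ker N\<close> of the image are independent.\<close>

lemma mrank_kron_square_diagonal:
  fixes A :: "'a::field mat"
  assumes A: "A \<in> carrier_mat n n" and a: "a \<noteq> 0"
  defines "r \<equiv> mrank (A - a \<cdot>\<^sub>m 1\<^sub>m n)"
  assumes r: "2 * r \<le> n"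
  shows "(n - 2 * r) * r + r * (n - r) \<le> mrank (kron A A - (a * a) \<cdot>\<^sub>m 1\<^sub>m (n * n))"
proof -
  define N where "N = A - a \<cdot>\<^sub>m 1\<^sub>m n"
  have N: "N \<in> carrier_mat n n" unfolding N_def using A by (intro minus_carrier_mat) simp
  have rN: "r = mrank N" by (simp add: r_def N_def)
  obtain L Y where L: "L \<in> carrier_mat r n" and Y: "Y \<in> carrier_mat n r"
    and LNY: "L * N * Y = 1\<^sub>m r" using mrank_sandwich[OF N] unfolding rN by metis
  \<comment> \<open>The columns of \<open>F\<close> are a basis of im N, and \<open>L\<close> is a
    left inverse of \<open>F\<close>.\<close>
  define F where "F = N * Y"
  have F: "F \<in> carrier_mat n r" using N Y by (simp add: F_def)
  have LF: "L * F = 1\<^sub>m r" unfolding F_def using LNY assoc_mult_mat[OF L N Y] by simp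
  obtain U V where U: "U \<in> carrier_mat n (n - r)" and V: "V \<in> carrier_mat (n - r) n"
    and VU: "V * U = 1\<^sub>m (n - r)" and NU: "N * U = 0\<^sub>m n (n - r)"
    unfolding rN by (rule kernel_basis[OF N])
  have AU: "A * U = a \<cdot>\<^sub>m U" using NU unfolding N_def by (rule eigen_kernel[OF A U])
  \<comment> \<open>\<open>U * V\<close> projects onto ker N and \<open>F * L\<close> onto im N.
    Hence \<open>S\<close>, which is (1 - F L) U V, has as its rank the dimension of ker N modulo
    ker N \<inter> im N, at least (n - r) - r.\<close>
  define S where "S = U * V - F * (L * (U * V))"
  have UV: "U * V \<in> carrier_mat n n" using U V by simp
  have S: "S \<in> carrier_mat n n" unfolding S_def using F L UV by (intro minus_carrier_mat) simp
  have FLUV: "F * (L * (U * V)) \<in> carrier_mat n n" using F L UV by simp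
  have "n - r \<le> mrank (U * V)"
  proof -
    have "V * (U * V) * U = (V * U) * (V * U)"
      using U V by (simp add: mult_assoc_dim del: assoc_mult_mat)
    then show ?thesis using mrank_ge_of_sandwich[OF UV V U] unfolding VU by simp
  qed
  moreover have "U * V = S + F * (L * (U * V))" 
    using UV FLUV U F unfolding S_def by (intro eq_matI) auto
  then have "mrank (U * V) \<le> mrank S + r"
    using mrank_add_le[OF S FLUV] mrank_le_of_factor[of F n r "L * (U * V)" n] F L UV by auto
  ultimately have rS: "n - 2 * r \<le> mrank S" by simp
  let ?s = "mrank S"
  obtain L' Y' where L': "L' \<in> carrier_mat ?s n" and Y': "Y' \<in> carrier_mat n ?s"
    and LSY: "L' * S * Y' = 1\<^sub>m ?s" using mrank_sandwich[OF S] by metis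
  \<comment> \<open>These columns lie in ker N and are independent modulo im N by the certificate of
    \<open>S\<close>; they span the complement U' of the overview of this lemma.\<close>
  define W where "W = U * (V * Y')"
  have W: "W \<in> carrier_mat n ?s" using U V Y' by (simp add: W_def)
  have AW: "A * W = a \<cdot>\<^sub>m W"
  proof -
    have "A * W = (A * U) * (V * Y')" unfolding W_def using A U V Y'
      by (simp add: mult_assoc_dim del: assoc_mult_mat)
    then show ?thesis unfolding AU W_def using U V Y' by (simp add: mult_smult_assoc_mat[of _ n "n - r" _ ?s])
  qed
  \<comment> \<open>\<open>L1\<close> and \<open>L2\<close> are dual to \<open>W\<close> and
    \<open>F\<close>: \<open>L1\<close> inverts \<open>W\<close> and kills \<open>F\<close>,
    \<open>L2\<close> inverts \<open>F\<close> and kills \<open>W\<close>.\<close>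
  define L1 where "L1 = L' - (L' * F) * L"
  have L1: "L1 \<in> carrier_mat ?s n" unfolding L1_def using L' F L
    by (intro minus_carrier_mat mult_carrier_mat[of _ ?s r] mult_carrier_mat[of _ ?s n])
  have L1_mult: "L1 * X = L' * X - L' * (F * (L * X))" if "X \<in> carrier_mat n k" for X k
    unfolding L1_def using L' F L that
    by (subst minus_mult_distrib_mat[of _ ?s n _ _ k]) (auto simp: mult_assoc_dim simp del: assoc_mult_mat)
  have L1W: "L1 * W = 1\<^sub>m ?s"
  proof -
    have "S * Y' = W - F * (L * W)" unfolding S_def W_def using U V F L Y' UV FLUV
      by (subst minus_mult_distrib_mat[of _ n n _ _ ?s]) (auto simp: mult_assoc_dim simp del: assoc_mult_mat)
    then have "L' * (S * Y') = L1 * W" unfolding L1_mult[OF W] using L' F L W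
      by (simp add: mult_minus_distrib_mat[of _ ?s n _ ?s])
    then show ?thesis using LSY assoc_mult_mat[OF L' S Y'] by simp
  qed
  have L1F: "L1 * F = 0\<^sub>m ?s r" unfolding L1_mult[OF F] LF using L' F by simp
  define L2 where "L2 = L - (L * W) * L1"
  have LW: "L * W \<in> carrier_mat r ?s" using L W by simp
  have L2: "L2 \<in> carrier_mat r n" unfolding L2_def
    by (rule minus_carrier_mat[OF mult_carrier_mat[OF LW L1]])
  have L2_mult: "L2 * X = L * X - L * W * (L1 * X)" if "X \<in> carrier_mat n k" for X k
    unfolding L2_def using L LW L1 that
    by (subst minus_mult_distrib_mat[of _ r n _ _ k]) (auto simp: mult_assoc_dim simp del: assoc_mult_mat)
  have L2W: "L2 * W = 0\<^sub>m r ?s" unfolding L2_mult[OF W] L1W right_mult_one_mat[OF LW]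
    by (rule minus_r_inv_mat[OF LW])
  have L2F: "L2 * F = 1\<^sub>m r" unfolding L2_mult[OF F] L1F LF right_mult_zero_mat[OF LW]
    by (intro eq_matI) auto
  let ?M = "kron A A - (a * a) \<cdot>\<^sub>m 1\<^sub>m (n * n)"
  have M: "?M \<in> carrier_mat (n * n) (n * n)" using A by (intro minus_carrier_mat) simp
  have carr: "kron L1 L \<in> carrier_mat (?s * r) (n * n)" "kron W Y \<in> carrier_mat (n * n) (?s * r)"
     "kron L2 V \<in> carrier_mat (r * (n - r)) (n * n)" "kron Y U \<in> carrier_mat (n * n) (r * (n - r))"
    using L1 L W Y L2 V U by auto
  have MWY: "?M * kron W Y = a \<cdot>\<^sub>m kron W F"
    using kron_square_minus_mult_left(1)[OF A W Y AW] by (simp add: F_def N_def)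
  have MYU: "?M * kron Y U = a \<cdot>\<^sub>m kron F U"
    using kron_square_minus_mult_left(2)[OF A U Y AU] by (simp add: F_def N_def)
  have cancel: "inverse a \<cdot>\<^sub>m (P * (a \<cdot>\<^sub>m Q)) = P * Q" if "P \<in> carrier_mat p q" "Q \<in> carrier_mat q t"
    for P Q :: "'a mat" and p q t
    using that a by (simp add: mult_smult_distrib[of _ p q _ t]) (auto intro!: eq_matI)
  have WF: "kron W F \<in> carrier_mat (n * n) (?s * r)" and FU: "kron F U \<in> carrier_mat (n * n) (r * (n - r))"
    using W F U by auto
  \<comment> \<open>A triangular pair of certificates: the diagonal blocks are L1 W \<otimes> L F
    and L2 F \<otimes> V U, the lower left one is L2 W \<otimes> V F = 0. The factor
    \<open>inverse a\<close> cancels the scalar produced by the eigenvectors.\<close>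
  have "(inverse a \<cdot>\<^sub>m kron L1 L) * ?M * kron W Y = kron (L1 * W) (L * F)"
    unfolding sandwich_smult[OF M carr(1,2)] MWY cancel[OF carr(1) WF] using L1 W L F by (rule kron_mult)
  then have 11: "(inverse a \<cdot>\<^sub>m kron L1 L) * ?M * kron W Y = 1\<^sub>m (?s * r)"
    by (simp add: L1W LF kron_one)
  have "(inverse a \<cdot>\<^sub>m kron L2 V) * ?M * kron W Y = kron (L2 * W) (V * F)"
    unfolding sandwich_smult[OF M carr(3,2)] MWY cancel[OF carr(3) WF] using L2 W V F by (rule kron_mult)
  then have 21: "(inverse a \<cdot>\<^sub>m kron L2 V) * ?M * kron W Y = 0\<^sub>m (r * (n - r)) (?s * r)"
    using V F by (simp add: L2W kron_zero_left[of _ "n - r" r])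
  have "(inverse a \<cdot>\<^sub>m kron L2 V) * ?M * kron Y U = kron (L2 * F) (V * U)"
    unfolding sandwich_smult[OF M carr(3,4)] MYU cancel[OF carr(3) FU] using L2 F V U by (rule kron_mult)
  then have 22: "(inverse a \<cdot>\<^sub>m kron L2 V) * ?M * kron Y U = 1\<^sub>m (r * (n - r))"
    by (simp add: L2F VU kron_one)
  have "?s * r + r * (n - r) \<le> mrank ?M"
    by (rule sandwich_triangular[OF M _ carr(2) _ carr(4) 11 21 22]) (use carr in auto)
  moreover have "(n - 2 * r) * r \<le> ?s * r" using rS by simp
  ultimately show ?thesis by linarith
qed

section \<open>Growth of the distance to the scalars under one tensor squaring\<close>

lemma invertible_mat_inverse:
  assumes "A \<in> carrier_mat n n" "invertible_mat A"
  obtains B where "B \<in> carrier_mat n n" "A * B = 1\<^sub>m n" "B * A = 1\<^sub>m n"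
proof -
  obtain B where B: "inverts_mat A B" "inverts_mat B A" 
    using assms(2) by (auto simp: invertible_mat_def)
  then have "A * B = 1\<^sub>m n" "B * A = 1\<^sub>m (dim_row B)" using assms(1) by (auto simp: inverts_mat_def)
  moreover from this have "B \<in> carrier_mat n n" using assms(1)
    by (metis carrier_matD carrier_matI index_mult_mat(2,3) index_one_mat(2,3))
  ultimately show thesis using that by auto
qed

lemma invertible_matI:
  "A \<in> carrier_mat n n \<Longrightarrow> B \<in> carrier_mat n n \<Longrightarrow> A * B = 1\<^sub>m n \<Longrightarrow> B * A = 1\<^sub>m n \<Longrightarrow> invertible_mat A"
  by (auto simp: invertible_mat_def inverts_mat_def)

lemma mrank_smult_one:
  fixes c :: "'a::field"
  assumes "c \<noteq> 0"
  shows "mrank (c \<cdot>\<^sub>m 1\<^sub>m n) = n"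
proof -
  have "inverse c \<cdot>\<^sub>m (c \<cdot>\<^sub>m 1\<^sub>m n) = (1\<^sub>m n :: 'a mat)" using assms by (intro eq_matI) auto
  then have "n \<le> mrank (c \<cdot>\<^sub>m 1\<^sub>m n)"
    using mrank_smult_le[of "c \<cdot>\<^sub>m 1\<^sub>m n" n n "inverse c"] by (simp add: mrank_one)
  then show ?thesis using mrank_le_dim_row[of "c \<cdot>\<^sub>m 1\<^sub>m n" n n] by simp
qed

text \<open>Triangularizing the first factor turns A \<otimes> A - c into T \<otimes> A - c, whose
  diagonal blocks are t A - c = t (A - c/t). The diagonal entries t of T are nonzero because A is
  invertible, so each block inherits the bound \<open>s\<close>.\<close>

lemma mrank_kron_square_ge:
  fixes A :: "complex mat"
  assumes A: "A \<in> carrier_mat n n" and inv: "invertible_mat A"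
    and s: "\<And>b. s \<le> mrank (A - b \<cdot>\<^sub>m 1\<^sub>m n)"
  shows "n * s \<le> mrank (kron A A - c \<cdot>\<^sub>m 1\<^sub>m (n * n))"
proof -
  obtain es where "char_poly A = (\<Prod>a\<leftarrow>es. [:- a, 1:])" using char_poly_factorized[OF A] by auto
  then obtain T where T: "T \<in> carrier_mat n n" "upper_triangular T" and sim: "similar_mat A T"
    using schur_decomposition_exists[OF A] by blast
  obtain P Q where "similar_mat_wit A T P Q" using sim by (auto simp: similar_mat_def)
  note wit = similar_mat_witD2[OF A this]
  obtain B where B: "B \<in> carrier_mat n n" "A * B = 1\<^sub>m n" using invertible_mat_inverse[OF A inv] by metis
  have "det A * det B = 1" using det_mult[OF A B(1)] B(2) by simp
  then have "det T \<noteq> 0" using det_similar[OF sim] by auto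
  then have diag: "T $$ (i,i) \<noteq> 0" if "i < n" for i
    using det_upper_triangular[OF T(2,1)] T(1) that by (auto simp: diag_mat_def prod_list_zero_iff)
  have "s \<le> mrank (T $$ (i,i) \<cdot>\<^sub>m A - c \<cdot>\<^sub>m 1\<^sub>m n)" if "i < n" for i
  proof -
    let ?t = "T $$ (i,i)"
    have "inverse ?t \<cdot>\<^sub>m (?t \<cdot>\<^sub>m A - c \<cdot>\<^sub>m 1\<^sub>m n) = A - (c / ?t) \<cdot>\<^sub>m 1\<^sub>m n"
      using A diag[OF that] by (intro eq_matI) (auto simp: field_simps)
    moreover have "?t \<cdot>\<^sub>m A - c \<cdot>\<^sub>m 1\<^sub>m n \<in> carrier_mat n n" by (intro minus_carrier_mat) simp
    then have "mrank (inverse ?t \<cdot>\<^sub>m (?t \<cdot>\<^sub>m A - c \<cdot>\<^sub>m 1\<^sub>m n)) \<le> mrank (?t \<cdot>\<^sub>m A - c \<cdot>\<^sub>m 1\<^sub>m n)"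
      by (rule mrank_smult_le)
    ultimately show ?thesis using s[of "c / ?t"] by simp
  qed
  then have "n * s \<le> mrank (kron T A - c \<cdot>\<^sub>m 1\<^sub>m (n * n))"
    by (rule mrank_kron_upper_triangular[OF A T])
  \<comment> \<open>Conjugation acts on the first tensor factor only and fixes the scalar
    \<open>c\<close>; multiplying by its two factors cannot raise the rank.\<close>
  also have "kron T A - c \<cdot>\<^sub>m 1\<^sub>m (n * n) = 
      kron Q (1\<^sub>m n) * (kron A A - c \<cdot>\<^sub>m 1\<^sub>m (n * n)) * kron P (1\<^sub>m n)"
  proof -
    have QAP: "Q * A * P = T"
    proof -
      have "Q * A * P = (Q * P) * T * (Q * P)" unfolding wit(3)
        using wit(5-7) by (simp add: mult_assoc_dim del: assoc_mult_mat)
      then show ?thesis unfolding wit(2) using T by simp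
    qed
    have "kron Q (1\<^sub>m n) * (kron A A - c \<cdot>\<^sub>m 1\<^sub>m (n * n)) = kron (Q * A) A - c \<cdot>\<^sub>m kron Q (1\<^sub>m n)"
      using A wit(7) by (subst mult_minus_distrib_mat[of _ "n * n" "n * n" _ "n * n"])
        (auto simp: kron_mult[of _ n n _ n _ n n _ n] mult_smult_distrib[of _ "n * n" "n * n" _ "n * n"])
    moreover have "(kron (Q * A) A - c \<cdot>\<^sub>m kron Q (1\<^sub>m n)) * kron P (1\<^sub>m n) = 
        kron (Q * A * P) A - c \<cdot>\<^sub>m kron (Q * P) (1\<^sub>m n)"
      using A wit(6,7) by (subst minus_mult_distrib_mat[of _ "n * n" "n * n" _ _ "n * n"])
        (auto simp: kron_mult[of _ n n _ n _ n n _ n] mult_smult_assoc_mat[of _ "n * n" "n * n" _ "n * n"])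
    ultimately show ?thesis by (simp add: QAP wit(2) kron_one)
  qed
  also have "mrank \<dots> \<le> mrank (kron Q (1\<^sub>m n) * (kron A A - c \<cdot>\<^sub>m 1\<^sub>m (n * n)))"
    using wit(4-7) by (intro mrank_mult_le_left[of _ "n * n" "n * n" _ "n * n"] mult_carrier_mat minus_carrier_mat) auto
  also have "\<dots> \<le> mrank (kron A A - c \<cdot>\<^sub>m 1\<^sub>m (n * n))"
    using wit(4-7) by (intro mrank_mult_le_right[of _ "n * n" "n * n" _ "n * n"] minus_carrier_mat) auto
  finally show ?thesis .
qed

lemma scalar_gap_kron_square:
  fixes A :: "complex mat"
  assumes A: "A \<in> carrier_mat n n" and inv: "invertible_mat A"
    and gap: "\<And>b. d * real n \<le> real (mrank (A - b \<cdot>\<^sub>m 1\<^sub>m n))"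
  shows "min (5/4 * d) (1/4) * real (n * n) \<le> real (mrank (kron A A - c \<cdot>\<^sub>m 1\<^sub>m (n * n)))"
proof (cases "\<exists>a. 4 * mrank (A - a \<cdot>\<^sub>m 1\<^sub>m n) < n")
  case True
  then obtain a where a: "4 * mrank (A - a \<cdot>\<^sub>m 1\<^sub>m n) < n" by auto
  define r where "r = mrank (A - a \<cdot>\<^sub>m 1\<^sub>m n)"
  have r: "4 * r < n" using a by (simp add: r_def)
  show ?thesis
  proof (cases "c = a * a")
    case False
    have "real (n - r) * real (n - r) \<le> mrank (kron A A - c \<cdot>\<^sub>m 1\<^sub>m (n * n))"
      using mrank_kron_square_off_diagonal[OF A False] unfolding r_def
      by (simp flip: of_nat_mult)
    \<comment> \<open>The eigenspace has dimension above 3n/4; the cruder n/2 already yields the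
      required 1/4.\<close>
    moreover have "(1/2 * real n) * (1/2 * real n) \<le> real (n - r) * real (n - r)"
      using r by (intro mult_mono) auto
    moreover have "min (5/4 * d) (1/4) * real (n * n) \<le> 1/4 * real (n * n)"
      by (intro mult_right_mono) auto
    ultimately show ?thesis by simp
  next
    case True
    \<comment> \<open>With a = 0 the invertible matrix \<open>A\<close> itself would have rank below
      n/4.\<close>
    have "a \<noteq> 0"
    proof
      assume "a = 0"
      then have "A - a \<cdot>\<^sub>m 1\<^sub>m n = A" using A by (intro eq_matI) auto
      moreover obtain B where "B \<in> carrier_mat n n" "A * B = 1\<^sub>m n" 
        using invertible_mat_inverse[OF A inv] by metis
      then have "n \<le> mrank A" using mrank_mult_le_left[OF A, of B n] by (simp add: mrank_one)
      ultimately show False using r by (simp add: r_def)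
    qed
    then have "(n - 2 * r) * r + r * (n - r) \<le> mrank (kron A A - c \<cdot>\<^sub>m 1\<^sub>m (n * n))"
      unfolding True r_def using r by (intro mrank_kron_square_diagonal[OF A]) (auto simp: r_def)
    then have "real ((n - 2 * r) * r + r * (n - r)) \<le> real (mrank (kron A A - c \<cdot>\<^sub>m 1\<^sub>m (n * n)))"
      by (rule of_nat_mono)
    moreover have "real ((n - 2 * r) * r + r * (n - r)) = real r * (2 * real n - 3 * real r)"
    proof -
      have e: "real (n - 2 * r) = real n - 2 * real r" "real (n - r) = real n - real r"
        using r by (simp_all add: of_nat_diff)
      show ?thesis unfolding of_nat_add of_nat_mult e by (simp add: algebra_simps)
    qed
    \<comment> \<open>From 4r < n: 2n - 3r \<ge> 2n - (3/4) n.\<close>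
    moreover have "real r * (5/4 * real n) \<le> real r * (2 * real n - 3 * real r)"
      using r by (intro mult_left_mono) auto
    moreover have "(d * real n) * (5/4 * real n) \<le> real r * (5/4 * real n)"
      using gap[of a] by (intro mult_right_mono) (auto simp: r_def)
    moreover have "min (5/4 * d) (1/4) * real (n * n) \<le> (5/4 * d) * real (n * n)"
      by (intro mult_right_mono) auto
    ultimately show ?thesis by (simp add: algebra_simps)
  qed
next
  case False
  \<comment> \<open>n/4 rounded up: ranks are integers, so every rank that is at least n/4 is at
    least \<open>s\<close>.\<close>
  define s where "s = (n + 3) div 4"
  have "s \<le> mrank (A - b \<cdot>\<^sub>m 1\<^sub>m n)" for b
  proof -
    have "n \<le> 4 * mrank (A - b \<cdot>\<^sub>m 1\<^sub>m n)" using False by (meson not_le)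
    then show ?thesis unfolding s_def by linarith
  qed
  then have "n * s \<le> mrank (kron A A - c \<cdot>\<^sub>m 1\<^sub>m (n * n))"
    by (rule mrank_kron_square_ge[OF A inv])
  then have "real n * real s \<le> real (mrank (kron A A - c \<cdot>\<^sub>m 1\<^sub>m (n * n)))" 
    by (simp flip: of_nat_mult)
  moreover have "n \<le> 4 * s" unfolding s_def by linarith
  then have "real n * (1/4 * real n) \<le> real n * real s" by (intro mult_left_mono) auto
  moreover have "min (5/4 * d) (1/4) * real (n * n) \<le> 1/4 * real (n * n)"
    by (intro mult_right_mono) auto
  ultimately show ?thesis by simp
qed

section \<open>Iterated amplification\<close>

text \<open>The identity block is adjoined once, before any squaring; from then on the distance to
  all scalars is carried along by the squarings themselves.\<close>

fun amp :: "nat \<Rightarrow> 'a::semiring_1 mat \<Rightarrow> 'a mat" where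
  "amp 0 A = four_block_mat A (0\<^sub>m (dim_row A) (dim_row A)) (0\<^sub>m (dim_row A) (dim_row A)) (1\<^sub>m (dim_row A))"
| "amp (Suc N) A = kron (amp N A) (amp N A)"

fun amp_dim :: "nat \<Rightarrow> nat \<Rightarrow> nat" where
  "amp_dim 0 n = n + n"
| "amp_dim (Suc N) n = amp_dim N n * amp_dim N n"

lemma amp_dim_ge: "n \<le> amp_dim N n"
proof (induction N)
  case (Suc N)
  then show ?case using le_square[of "amp_dim N n"] by (metis amp_dim.simps(2) le_trans)
qed simp

lemma amp_carrier [simp]: "A \<in> carrier_mat n n \<Longrightarrow> amp N A \<in> carrier_mat (amp_dim N n) (amp_dim N n)"
  by (induction N) auto

lemma amp_mult:
  fixes A :: "'a::comm_semiring_1 mat"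
  assumes "A \<in> carrier_mat n n" "B \<in> carrier_mat n n"
  shows "amp N (A * B) = amp N A * amp N B"
proof (induction N)
  case 0
  show ?case using assms by (simp add: mult_four_block_mat[of _ n n _ n _ n _ _ n _ n])
next
  case (Suc N)
  let ?D = "amp_dim N n"
  show ?case using assms Suc by (simp add: kron_mult[of _ ?D ?D _ ?D _ ?D ?D _ ?D])
qed

lemma amp_one: "amp N (1\<^sub>m n) = (1\<^sub>m (amp_dim N n) :: 'a::comm_semiring_1 mat)"
  by (induction N) (auto simp: kron_one)

lemma amp_invertible:
  fixes A :: "'a::comm_semiring_1 mat"
  assumes A: "A \<in> carrier_mat n n" and inv: "invertible_mat A"
  shows "invertible_mat (amp N A)"
proof -
  obtain B where "B \<in> carrier_mat n n" "A * B = 1\<^sub>m n" "B * A = 1\<^sub>m n"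
    using invertible_mat_inverse[OF A inv] .
  then show ?thesis using A
    by (intro invertible_matI[of _ "amp_dim N n" "amp N B"]) (auto simp: amp_one simp flip: amp_mult)
qed

lemma rho_eq: "A \<in> carrier_mat n m \<Longrightarrow> rho A = real (mrank A) / real n"
  by (simp add: rho_def mrank_def)

text \<open>The identity X \<otimes> X - Y \<otimes> Y = (X - Y) \<otimes> X + Y \<otimes> (X - Y)
  costs at most a factor 2 per squaring.\<close>

lemma rho_amp_diff_le:
  fixes A :: "complex mat"
  assumes A: "A \<in> carrier_mat n n" and B: "B \<in> carrier_mat n n" and "0 < n"
  shows "rho (amp N A - amp N B) \<le> 2 ^ N * rho (A - B)"
proof (induction N)
  case 0
  have AB: "A - B \<in> carrier_mat n n" using B by (rule minus_carrier_mat)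
  \<comment> \<open>The identity blocks cancel, and the remaining corner \<open>A - B\<close> is
    written as a product so that the rank cannot grow.\<close>
  have "amp 0 A - amp 0 B = four_block_mat (1\<^sub>m n) (0\<^sub>m n 0) (0\<^sub>m n n) (0\<^sub>m n 0) * (A - B) *
     four_block_mat (1\<^sub>m n) (0\<^sub>m n n) (0\<^sub>m 0 n) (0\<^sub>m 0 n)" (is "_ = ?L * _ * ?R")
  proof -
    have AB': "A - B = four_block_mat (A - B) (0\<^sub>m n 0) (0\<^sub>m 0 n) (0\<^sub>m 0 0)"
      using AB by (intro eq_matI) auto
    have "?L * (A - B) = four_block_mat (A - B) (0\<^sub>m n 0) (0\<^sub>m n n) (0\<^sub>m n 0)"
      by (subst AB', subst mult_four_block_mat[of _ n n _ 0 _ n _ _ n _ 0])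
        (use AB in \<open>auto simp: left_mult_zero_mat[OF AB] left_mult_one_mat[OF AB]\<close>)
    then have "?L * (A - B) * ?R = four_block_mat (A - B) (0\<^sub>m n n) (0\<^sub>m n n) (0\<^sub>m n n)"
      by (simp, subst mult_four_block_mat[of _ n n _ 0 _ n _ _ n _ n])
        (use AB in \<open>auto simp: right_mult_zero_mat[OF AB] right_mult_one_mat[OF AB]\<close>)
    then show ?thesis using A B by (intro eq_matI) auto
  qed
  moreover have L: "?L \<in> carrier_mat (n + n) n" using four_block_carrier_mat[of "1\<^sub>m n" n n "0\<^sub>m n 0" n 0] by simp
  moreover have R: "?R \<in> carrier_mat n (n + n)" using four_block_carrier_mat[of "1\<^sub>m n" n n "0\<^sub>m 0 n" 0 n] by simp
  ultimately have "mrank (amp 0 A - amp 0 B) \<le> mrank (A - B)"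
    using mrank_mult_le_left[OF mult_carrier_mat[OF L AB] R] mrank_mult_le_right[OF L AB]
    by (metis le_trans)
  moreover have "amp 0 A - amp 0 B \<in> carrier_mat (n + n) (n + n)" 
    using B by (intro minus_carrier_mat) (metis amp_carrier amp_dim.simps(1))
  ultimately show ?case using \<open>0 < n\<close> by (simp add: rho_eq[OF AB] rho_eq[of _ "n + n" "n + n"] frac_le)
next
  case (Suc N)
  define D where "D = amp_dim N n"
  define X where "X = amp N A"
  define Y where "Y = amp N B"
  have X: "X \<in> carrier_mat D D" and Y: "Y \<in> carrier_mat D D" using A B by (auto simp: X_def Y_def D_def)
  have "0 < D" using amp_dim_ge[of n N] \<open>0 < n\<close> by (simp add: D_def)
  have XY: "X - Y \<in> carrier_mat D D" using Y by (rule minus_carrier_mat)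
  have diff: "kron X X - kron Y Y \<in> carrier_mat (D * D) (D * D)" using Y by (intro minus_carrier_mat) simp
  have "kron X X - kron Y Y = kron (X - Y) X + kron Y (X - Y)"
    using X Y by (subst kron_minus_left[of _ D D], simp, simp, subst kron_minus_right[of _ D D])
      (auto intro!: eq_matI)
  then have "mrank (kron X X - kron Y Y) \<le> mrank (X - Y) * D + D * mrank (X - Y)"
    using mrank_add_le[of "kron (X - Y) X" "D * D" "D * D" "kron Y (X - Y)"]
      mrank_kron_le_left[OF XY X] mrank_kron_le_right[OF Y XY] X Y XY by simp
  then have "real (mrank (kron X X - kron Y Y)) \<le> real (mrank (X - Y) * D + D * mrank (X - Y))"
    by (rule of_nat_mono)
  then have "real (mrank (kron X X - kron Y Y)) \<le> 2 * real (mrank (X - Y)) * real D" by (simp add: mult_ac)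
  then have "rho (kron X X - kron Y Y) \<le> 2 * rho (X - Y)"
    using \<open>0 < D\<close> by (simp add: rho_eq[OF diff] rho_eq[OF XY] field_simps)
  then show ?case using Suc by (simp add: X_def Y_def)
qed

text \<open>For N = 0 and c = 1 the block \<open>A - 1\<close> supplies the rank; for other c the
  block 1 - c has full rank, which suffices as \<open>d \<le> 1\<close>. The dimension has doubled,
  hence d/2.\<close>

lemma scalar_gap_amp:
  fixes A :: "complex mat"
  assumes A: "A \<in> carrier_mat n n" and inv: "invertible_mat A"
    and d: "d * real n \<le> real (mrank (A - 1\<^sub>m n))" "d \<le> 1"
  shows "min ((5/4) ^ N * (d / 2)) (1/4) * real (amp_dim N n) 
    \<le> real (mrank (amp N A - c \<cdot>\<^sub>m 1\<^sub>m (amp_dim N n)))"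
proof (induction N arbitrary: c)
  case 0
  have "amp 0 A - c \<cdot>\<^sub>m 1\<^sub>m (n + n) = 
      four_block_mat (A - c \<cdot>\<^sub>m 1\<^sub>m n) (0\<^sub>m n n) (0\<^sub>m n n) ((1 - c) \<cdot>\<^sub>m 1\<^sub>m n)"
    using A by (intro eq_matI) auto
  then have "mrank (A - c \<cdot>\<^sub>m 1\<^sub>m n) + mrank ((1 - c) \<cdot>\<^sub>m 1\<^sub>m n :: complex mat) \<le> mrank (amp 0 A - c \<cdot>\<^sub>m 1\<^sub>m (n + n))"
    using mrank_four_block_triangular[of "A - c \<cdot>\<^sub>m 1\<^sub>m n" n "0\<^sub>m n n" n "(1 - c) \<cdot>\<^sub>m 1\<^sub>m n"]
    by (simp add: minus_carrier_mat)
  moreover have "d * real n \<le> mrank (A - c \<cdot>\<^sub>m 1\<^sub>m n) + mrank ((1 - c) \<cdot>\<^sub>m 1\<^sub>m n :: complex mat)"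
  proof (cases "c = 1")
    case True
    then have "A - c \<cdot>\<^sub>m 1\<^sub>m n = A - 1\<^sub>m n" using A by (intro eq_matI) auto
    then show ?thesis using d(1) by simp
  next
    case False
    then have "mrank ((1 - c) \<cdot>\<^sub>m 1\<^sub>m n :: complex mat) = n" by (intro mrank_smult_one) simp
    moreover have "d * real n \<le> 1 * real n" using d(2) by (intro mult_right_mono) auto
    ultimately show ?thesis by simp
  qed
  moreover have "min ((5/4) ^ 0 * (d / 2)) (1/4) * real (n + n) \<le> d / 2 * real (n + n)"
    by (intro mult_right_mono) auto
  ultimately show ?case by simp
next
  case (Suc N)
  have "min (5/4 * min ((5/4) ^ N * (d / 2)) (1/4)) (1/4) * real (amp_dim N n * amp_dim N n)
    \<le> real (mrank (kron (amp N A) (amp N A) - c \<cdot>\<^sub>m 1\<^sub>m (amp_dim N n * amp_dim N n)))"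
    using A inv Suc by (intro scalar_gap_kron_square amp_invertible) auto
  \<comment> \<open>Truncating at 1/4 before multiplying by 5/4 has no effect on the truncated
    result.\<close>
  moreover have "min (5/4 * min ((5/4) ^ N * (d / 2)) (1/4)) (1/4) = min ((5/4) ^ Suc N * (d / 2)) (1/4)"
  proof -
    have "min (5/4 * min x (1/4)) (1/4) = min (5/4 * x) (1/4)" for x :: real
      by (auto simp: min_def)
    then show ?thesis by (simp only: power_Suc mult.assoc)
  qed
  ultimately show ?case by simp
qed

section \<open>Normalized rank as an invariant distance\<close>

lemma rho_nonneg: "0 \<le> rho A"
  by (simp add: rho_def)

lemma rho_le_one: "A \<in> carrier_mat n m \<Longrightarrow> rho A \<le> 1"
  using mrank_le_dim_row[of A n m] by (cases "n = 0") (simp_all add: rho_eq)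

lemma rho_zero: "rho (0\<^sub>m n m) = 0"
  using vec_space.rank_0I[of n m, where ?'a = complex] by (simp add: rho_def)

lemma rho_mult_le_left:
  "A \<in> carrier_mat n n \<Longrightarrow> B \<in> carrier_mat n n \<Longrightarrow> rho (A * B) \<le> rho A"
  using mrank_mult_le_left[of A n n B n] by (simp add: rho_eq[of _ n n] divide_right_mono)

lemma rho_mult_le_right:
  "A \<in> carrier_mat n n \<Longrightarrow> B \<in> carrier_mat n n \<Longrightarrow> rho (A * B) \<le> rho B"
  using mrank_mult_le_right[of A n n B n] by (simp add: rho_eq[of _ n n] divide_right_mono)

lemma rho_minus_commute:
  assumes "A \<in> carrier_mat n n" "B \<in> carrier_mat n n"
  shows "rho (A - B) = rho (B - A)"
proof -
  have le: "rho (X - Y) \<le> rho (Y - X)" if X: "X \<in> carrier_mat n n" and Y: "Y \<in> carrier_mat n n" for X Y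
  proof -
    have "X - Y = (- 1) \<cdot>\<^sub>m (Y - X)" using X Y by (intro eq_matI) auto
    moreover have YX: "Y - X \<in> carrier_mat n n" "X - Y \<in> carrier_mat n n"
      using X Y by (auto intro: minus_carrier_mat)
    ultimately have "mrank (X - Y) \<le> mrank (Y - X)" using mrank_smult_le[OF YX(1)] by metis
    then show ?thesis unfolding rho_eq[OF YX(1)] rho_eq[OF YX(2)] by (simp add: divide_right_mono)
  qed
  show ?thesis using le[OF assms] le[OF assms(2,1)] by simp
qed

lemma rho_triangle:
  assumes A: "A \<in> carrier_mat n n" and B: "B \<in> carrier_mat n n" and C: "C \<in> carrier_mat n n"
  shows "rho (A - C) \<le> rho (A - B) + rho (B - C)"
proof -
  have AB: "A - B \<in> carrier_mat n n" and BC: "B - C \<in> carrier_mat n n" and AC: "A - C \<in> carrier_mat n n"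
    using B C by (auto intro: minus_carrier_mat)
  have "A - C = (A - B) + (B - C)" using A B C by (intro eq_matI) auto
  then have "mrank (A - C) \<le> mrank (A - B) + mrank (B - C)" using mrank_add_le[OF AB BC] by simp
  then have "real (mrank (A - C)) \<le> real (mrank (A - B)) + real (mrank (B - C))" by linarith
  then show ?thesis unfolding rho_eq[OF AB] rho_eq[OF BC] rho_eq[OF AC]
    by (simp add: divide_right_mono flip: add_divide_distrib)
qed

lemma rho_mult_right_diff_le:
  assumes A: "A \<in> carrier_mat n n" and B: "B \<in> carrier_mat n n" and C: "C \<in> carrier_mat n n"
  shows "rho (A * C - B * C) \<le> rho (A - B)"
proof -
  have "A * C - B * C = (A - B) * C" using A B C by (simp add: minus_mult_distrib_mat[of _ n n _ _ n])
  then show ?thesis using rho_mult_le_left[of "A - B" n C] minus_carrier_mat[OF B] C by simp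
qed

lemma rho_mult_left_diff_le:
  assumes A: "A \<in> carrier_mat n n" and B: "B \<in> carrier_mat n n" and C: "C \<in> carrier_mat n n"
  shows "rho (C * A - C * B) \<le> rho (A - B)"
proof -
  have "C * A - C * B = C * (A - B)" using A B C by (simp add: mult_minus_distrib_mat[of _ n n _ n])
  then show ?thesis using rho_mult_le_right[of C n "A - B"] minus_carrier_mat[OF B] C by simp
qed

section \<open>The product group, its null subgroup and the cosets\<close>

lemma prodGL_carrier:
  "a \<in> carrier (prodGL n) \<longleftrightarrow> (\<forall>k. a k \<in> carrier_mat (n k) (n k) \<and> invertible_mat (a k))"
  by (simp add: prodGL_def)

lemma prodGL_carrierD: "a \<in> carrier (prodGL n) \<Longrightarrow> a k \<in> carrier_mat (n k) (n k)"
  by (simp add: prodGL_carrier)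

lemma prodGL_mult: "a \<otimes>\<^bsub>prodGL n\<^esub> b = (\<lambda>k. a k * b k)"
  by (simp add: prodGL_def)

lemma prodGL_one: "\<one>\<^bsub>prodGL n\<^esub> = (\<lambda>k. 1\<^sub>m (n k))"
  by (simp add: prodGL_def)

lemma invertible_mat_mult:
  assumes A: "A \<in> carrier_mat n n" "invertible_mat A" and B: "B \<in> carrier_mat n n" "invertible_mat B"
  shows "invertible_mat (A * B)"
proof -
  obtain A' where A': "A' \<in> carrier_mat n n" "A * A' = 1\<^sub>m n" "A' * A = 1\<^sub>m n"
    using invertible_mat_inverse[OF A] .
  obtain B' where B': "B' \<in> carrier_mat n n" "B * B' = 1\<^sub>m n" "B' * B = 1\<^sub>m n"
    using invertible_mat_inverse[OF B] .
  have "A * B * (B' * A') = A * (B * B') * A'" "B' * A' * (A * B) = B' * (A' * A) * B"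
    using A(1) B(1) A'(1) B'(1) by (simp_all add: mult_assoc_dim del: assoc_mult_mat)
  then show ?thesis using A B A' B' by (intro invertible_matI[of _ n "B' * A'"]) auto
qed

lemma group_prodGL: "group (prodGL n)"
proof (rule groupI)
  show "x \<otimes>\<^bsub>prodGL n\<^esub> y \<in> carrier (prodGL n)"
    if "x \<in> carrier (prodGL n)" "y \<in> carrier (prodGL n)" for x y
    using that by (auto simp: prodGL_carrier prodGL_mult intro: invertible_mat_mult mult_carrier_mat)
  show "\<one>\<^bsub>prodGL n\<^esub> \<in> carrier (prodGL n)"
    by (auto simp: prodGL_carrier prodGL_one intro!: invertible_matI[OF one_carrier_mat one_carrier_mat])
  show "x \<otimes>\<^bsub>prodGL n\<^esub> y \<otimes>\<^bsub>prodGL n\<^esub> z = x \<otimes>\<^bsub>prodGL n\<^esub> (y \<otimes>\<^bsub>prodGL n\<^esub> z)"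
    if "x \<in> carrier (prodGL n)" "y \<in> carrier (prodGL n)" "z \<in> carrier (prodGL n)" for x y z
    using that[THEN prodGL_carrierD] by (auto simp: prodGL_mult intro!: assoc_mult_mat)
  show "\<one>\<^bsub>prodGL n\<^esub> \<otimes>\<^bsub>prodGL n\<^esub> x = x" if "x \<in> carrier (prodGL n)" for x
    using prodGL_carrierD[OF that] unfolding prodGL_mult prodGL_one
    by (intro ext left_mult_one_mat)
  show "\<exists>y\<in>carrier (prodGL n). y \<otimes>\<^bsub>prodGL n\<^esub> x = \<one>\<^bsub>prodGL n\<^esub>" if x: "x \<in> carrier (prodGL n)" for x
  proof -
    have "\<exists>B. B \<in> carrier_mat (n k) (n k) \<and> x k * B = 1\<^sub>m (n k) \<and> B * x k = 1\<^sub>m (n k)" for k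
      using x invertible_mat_inverse[of "x k" "n k"] unfolding prodGL_carrier by metis
    then obtain y where y: "\<And>k. y k \<in> carrier_mat (n k) (n k) \<and> x k * y k = 1\<^sub>m (n k) \<and> y k * x k = 1\<^sub>m (n k)"
      by metis
    then have "y \<in> carrier (prodGL n)" using x unfolding prodGL_carrier
      by (metis invertible_matI)
    then show ?thesis using y by (intro bexI[of _ y]) (auto simp: prodGL_mult prodGL_one)
  qed
qed

lemma prodGL_inv:
  assumes "a \<in> carrier (prodGL n)"
  shows "inv\<^bsub>prodGL n\<^esub> a \<in> carrier (prodGL n)" 
    "a k * (inv\<^bsub>prodGL n\<^esub> a) k = 1\<^sub>m (n k)" "(inv\<^bsub>prodGL n\<^esub> a) k * a k = 1\<^sub>m (n k)"
proof -
  interpret group "prodGL n" by (rule group_prodGL)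
  show "inv\<^bsub>prodGL n\<^esub> a \<in> carrier (prodGL n)" using assms by simp
  show "a k * (inv\<^bsub>prodGL n\<^esub> a) k = 1\<^sub>m (n k)" using r_inv[OF assms]
    unfolding prodGL_mult prodGL_one by (rule fun_cong)
  show "(inv\<^bsub>prodGL n\<^esub> a) k * a k = 1\<^sub>m (n k)" using l_inv[OF assms]
    unfolding prodGL_mult prodGL_one by (rule fun_cong)
qed

lemma tendsto_zero_le:
  fixes f g :: "'a \<Rightarrow> real"
  assumes "(g \<longlongrightarrow> 0) F" "\<And>k. 0 \<le> f k" "\<And>k. f k \<le> g k"
  shows "(f \<longlongrightarrow> 0) F"
  by (rule tendsto_sandwich[of "\<lambda>_. 0" f F g]) (use assms in auto)

text \<open>Right multiplication does not increase the distance; applied to the inverse of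
  \<open>b\<close> and then to \<open>b\<close> itself, this gives both directions.\<close>

lemma rho_mult_inv_diff_one_le:
  assumes "a \<in> carrier (prodGL n)" "b \<in> carrier (prodGL n)"
  shows "rho ((a \<otimes>\<^bsub>prodGL n\<^esub> inv\<^bsub>prodGL n\<^esub> b) k - 1\<^sub>m (n k)) \<le> rho (a k - b k)"
    and "rho (a k - b k) \<le> rho ((a \<otimes>\<^bsub>prodGL n\<^esub> inv\<^bsub>prodGL n\<^esub> b) k - 1\<^sub>m (n k))"
proof -
  let ?b = "(inv\<^bsub>prodGL n\<^esub> b) k"
  note b' = prodGL_inv[OF assms(2)]
  note c = prodGL_carrierD[OF assms(1), of k] prodGL_carrierD[OF assms(2), of k] prodGL_carrierD[OF b'(1), of k]
  show "rho ((a \<otimes>\<^bsub>prodGL n\<^esub> inv\<^bsub>prodGL n\<^esub> b) k - 1\<^sub>m (n k)) \<le> rho (a k - b k)"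
    using rho_mult_right_diff_le[OF c(1,2,3)] unfolding b'(2) prodGL_mult .
  have "a k * ?b * b k = a k" unfolding assoc_mult_mat[OF c(1,3,2)] b'(3) using c by simp
  then show "rho (a k - b k) \<le> rho ((a \<otimes>\<^bsub>prodGL n\<^esub> inv\<^bsub>prodGL n\<^esub> b) k - 1\<^sub>m (n k))"
    using rho_mult_right_diff_le[OF mult_carrier_mat[OF c(1,3)] one_carrier_mat c(2)] c
    unfolding prodGL_mult by simp
qed

lemma nullGL_iff:
  assumes "a \<in> carrier (prodGL n)" "b \<in> carrier (prodGL n)"
  shows "a \<otimes>\<^bsub>prodGL n\<^esub> inv\<^bsub>prodGL n\<^esub> b \<in> nullGL \<omega> n \<longleftrightarrow> ((\<lambda>k. rho (a k - b k)) \<longlongrightarrow> 0) \<omega>"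
proof -
  interpret group "prodGL n" by (rule group_prodGL)
  have "a \<otimes>\<^bsub>prodGL n\<^esub> inv\<^bsub>prodGL n\<^esub> b \<in> carrier (prodGL n)" using assms by simp
  moreover have "rho ((a \<otimes>\<^bsub>prodGL n\<^esub> inv\<^bsub>prodGL n\<^esub> b) k - 1\<^sub>m (n k)) = rho (a k - b k)" for k
    using rho_mult_inv_diff_one_le[OF assms, of k] by simp
  ultimately show ?thesis by (simp add: nullGL_def)
qed

lemma normal_nullGL: "nullGL \<omega> n \<lhd> prodGL n"
proof -
  interpret group "prodGL n" by (rule group_prodGL)
  let ?G = "prodGL n" and ?N = "nullGL \<omega> n"
  have "subgroup ?N ?G"
  proof (rule subgroupI)
    show "?N \<subseteq> carrier ?G" by (auto simp: nullGL_def)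
    have "\<one>\<^bsub>?G\<^esub> \<in> ?N"
      using one_closed unfolding nullGL_def
      by (simp add: minus_r_inv_mat[OF one_carrier_mat] prodGL_one rho_zero)
    then show "?N \<noteq> {}" by auto
    fix a assume a: "a \<in> ?N"
    then have ac: "a \<in> carrier ?G" by (simp add: nullGL_def)
    have "rho (\<one>\<^bsub>?G\<^esub> k - a k) = rho (a k - 1\<^sub>m (n k))" for k
      using prodGL_carrierD[OF ac, of k] unfolding prodGL_one by (intro rho_minus_commute) auto
    then have "\<one>\<^bsub>?G\<^esub> \<otimes>\<^bsub>?G\<^esub> inv\<^bsub>?G\<^esub> a \<in> ?N"
      using nullGL_iff[OF one_closed ac] a by (simp add: nullGL_def)
    then show "inv\<^bsub>?G\<^esub> a \<in> ?N" using ac by simp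
    fix b assume b: "b \<in> ?N"
    then have bc: "b \<in> carrier ?G" by (simp add: nullGL_def)
    have le: "rho ((a \<otimes>\<^bsub>?G\<^esub> b) k - 1\<^sub>m (n k)) \<le> rho (a k - 1\<^sub>m (n k)) + rho (b k - 1\<^sub>m (n k))" for k
    proof -
      note c = prodGL_carrierD[OF ac, of k] prodGL_carrierD[OF bc, of k]
      show ?thesis
        using rho_triangle[OF mult_carrier_mat[OF c] c(2) one_carrier_mat]
          rho_mult_right_diff_le[OF c(1) one_carrier_mat c(2)] c unfolding prodGL_mult by simp
    qed
    have "((\<lambda>k. rho (a k - 1\<^sub>m (n k)) + rho (b k - 1\<^sub>m (n k))) \<longlongrightarrow> 0) \<omega>"
      using tendsto_add[of "\<lambda>k. rho (a k - 1\<^sub>m (n k))" 0 \<omega> "\<lambda>k. rho (b k - 1\<^sub>m (n k))" 0] a b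
      by (simp add: nullGL_def)
    then have "((\<lambda>k. rho ((a \<otimes>\<^bsub>?G\<^esub> b) k - 1\<^sub>m (n k))) \<longlongrightarrow> 0) \<omega>"
      by (rule tendsto_zero_le[OF _ rho_nonneg le])
    then show "a \<otimes>\<^bsub>?G\<^esub> b \<in> ?N" using m_closed[OF ac bc] by (simp add: nullGL_def)
  qed
  moreover have "x \<otimes>\<^bsub>?G\<^esub> h \<otimes>\<^bsub>?G\<^esub> inv\<^bsub>?G\<^esub> x \<in> ?N" if x: "x \<in> carrier ?G" and h: "h \<in> ?N" for x h
  proof -
    have hc: "h \<in> carrier ?G" using h by (simp add: nullGL_def)
    \<comment> \<open>Normality reduces to x h being close to x, and x h - x = x (h - 1).\<close>
    have le: "rho ((x \<otimes>\<^bsub>?G\<^esub> h) k - x k) \<le> rho (h k - 1\<^sub>m (n k))" for k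
      using rho_mult_left_diff_le[OF prodGL_carrierD[OF hc, of k] one_carrier_mat prodGL_carrierD[OF x, of k]]
        prodGL_carrierD[OF x, of k] unfolding prodGL_mult by simp
    have "((\<lambda>k. rho ((x \<otimes>\<^bsub>?G\<^esub> h) k - x k)) \<longlongrightarrow> 0) \<omega>"
      by (rule tendsto_zero_le[OF _ rho_nonneg le]) (use h in \<open>simp add: nullGL_def\<close>)
    then show ?thesis using nullGL_iff[OF m_closed[OF x hc] x] by simp
  qed
  ultimately show ?thesis unfolding normal_inv_iff by auto
qed

lemma mem_nullGL_coset_iff:
  assumes "a \<in> carrier (prodGL n)" "b \<in> carrier (prodGL n)"
  shows "b \<in> nullGL \<omega> n #>\<^bsub>prodGL n\<^esub> a \<longleftrightarrow> ((\<lambda>k. rho (b k - a k)) \<longlongrightarrow> 0) \<omega>"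
  using subgroup.rcos_module[OF normal_imp_subgroup[OF normal_nullGL] group_prodGL assms]
    nullGL_iff[OF assms(2,1)] by simp

section \<open>Limits along ultrafilters\<close>

text \<open>Compactness gives a cluster point, and an ultrafilter converges to each of its cluster
  points.\<close>

lemma ultrafilter_bounded_convergent:
  fixes f :: "nat \<Rightarrow> real"
  assumes \<omega>: "ultrafilter_on_nat \<omega>" and f: "\<And>k. f k \<in> {a..b}"
  shows "\<exists>l. (f \<longlongrightarrow> l) \<omega>"
proof -
  have "filtermap f \<omega> \<noteq> bot" using \<omega> by (simp add: ultrafilter_on_nat_def filtermap_bot_iff)
  moreover have "eventually (\<lambda>x. x \<in> {a..b}) (filtermap f \<omega>)" using f by (simp add: eventually_filtermap)
  ultimately obtain l where l: "inf (nhds l) (filtermap f \<omega>) \<noteq> bot"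
    using compact_Icc[of a b] unfolding compact_filter by metis
  have "(f \<longlongrightarrow> l) \<omega>"
  proof (rule topological_tendstoI)
    fix S assume S: "open S" "l \<in> S"
    show "eventually (\<lambda>k. f k \<in> S) \<omega>"
    proof (rule ccontr)
      assume "\<not> ?thesis"
      then have "eventually (\<lambda>k. f k \<notin> S) \<omega>" using \<omega> by (auto simp: ultrafilter_on_nat_def)
      then have "eventually (\<lambda>x. x \<notin> S) (filtermap f \<omega>)" by (simp add: eventually_filtermap)
      moreover have "eventually (\<lambda>x. x \<in> S) (nhds l)" using S by (auto simp: eventually_nhds)
      ultimately have "eventually (\<lambda>_. False) (inf (nhds l) (filtermap f \<omega>))"
        unfolding eventually_inf by blast
      then show False using l by (simp add: trivial_limit_def)
    qed
  qed
  then show ?thesis by blast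
qed

text \<open>\<open>d_omega\<close> takes \<open>Lim\<close> over representatives picked by choice.
  So the limit must be shown to exist, and the bound for \<open>a\<close> must be moved to the
  chosen \<open>x\<close> and \<open>y\<close>, which differ from \<open>a\<close> and the identity
  by null sequences.\<close>

lemma d_omega_coset_ge:
  assumes \<omega>: "ultrafilter_on_nat \<omega>" and a: "a \<in> carrier (prodGL n)"
    and ge: "eventually (\<lambda>k. c \<le> rho (a k - 1\<^sub>m (n k))) \<omega>"
  shows "c \<le> d_omega \<omega> (nullGL \<omega> n #>\<^bsub>prodGL n\<^esub> a) \<one>\<^bsub>ultraGL \<omega> n\<^esub>"
proof -
  interpret group "prodGL n" by (rule group_prodGL)
  interpret normal "nullGL \<omega> n" "prodGL n" by (rule normal_nullGL)
  define x where "x = (SOME x. x \<in> nullGL \<omega> n #>\<^bsub>prodGL n\<^esub> a)"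
  define y where "y = (SOME y. y \<in> nullGL \<omega> n)"
  have x: "x \<in> nullGL \<omega> n #>\<^bsub>prodGL n\<^esub> a"
    unfolding x_def by (rule someI[of _ a]) (rule rcos_self[OF a is_subgroup])
  then have xc: "x \<in> carrier (prodGL n)" using a r_coset_subset_G[OF subset] by blast
  have y: "y \<in> nullGL \<omega> n" unfolding y_def by (rule someI[of _ "\<one>\<^bsub>prodGL n\<^esub>"]) (rule one_closed)
  then have yc: "y \<in> carrier (prodGL n)" using subset by blast
  have d: "d_omega \<omega> (nullGL \<omega> n #>\<^bsub>prodGL n\<^esub> a) \<one>\<^bsub>ultraGL \<omega> n\<^esub> = Lim \<omega> (\<lambda>k. rho (x k - y k))"
    by (simp add: d_omega_def ultraGL_def FactGroup_def x_def y_def)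
  have car: "a k \<in> carrier_mat (n k) (n k)" "x k \<in> carrier_mat (n k) (n k)" "y k \<in> carrier_mat (n k) (n k)" for k
    using a xc yc by (auto simp: prodGL_carrier)
  have "rho (x k - y k) \<in> {0..1}" for k
    using rho_nonneg rho_le_one[OF minus_carrier_mat[OF car(3)[of k]], of "x k"] by simp
  then obtain l where l: "((\<lambda>k. rho (x k - y k)) \<longlongrightarrow> l) \<omega>"
    using ultrafilter_bounded_convergent[OF \<omega>, of "\<lambda>k. rho (x k - y k)" 0 1] by blast
  have ntr: "\<omega> \<noteq> bot" using \<omega> by (simp add: ultrafilter_on_nat_def)
  have xa: "((\<lambda>k. rho (x k - a k)) \<longlongrightarrow> 0) \<omega>" using x unfolding mem_nullGL_coset_iff[OF a xc] .
  have y1: "((\<lambda>k. rho (y k - 1\<^sub>m (n k))) \<longlongrightarrow> 0) \<omega>" using y unfolding nullGL_def by blast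
  have "((\<lambda>k. rho (x k - a k) + rho (x k - y k) + rho (y k - 1\<^sub>m (n k))) \<longlongrightarrow> 0 + l + 0) \<omega>"
    by (intro tendsto_add xa l y1)
  moreover have "eventually (\<lambda>k. c \<le> rho (x k - a k) + rho (x k - y k) + rho (y k - 1\<^sub>m (n k))) \<omega>"
    using ge
  proof eventually_elim
    case (elim k)
    have "rho (a k - 1\<^sub>m (n k)) \<le> rho (a k - x k) + rho (x k - 1\<^sub>m (n k))"
      using car[of k] by (intro rho_triangle) auto
    moreover have "rho (x k - 1\<^sub>m (n k)) \<le> rho (x k - y k) + rho (y k - 1\<^sub>m (n k))"
      using car[of k] by (intro rho_triangle) auto
    moreover have "rho (a k - x k) = rho (x k - a k)" using car[of k] by (intro rho_minus_commute) auto
    ultimately show ?case using elim by simp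
  qed
  ultimately have "c \<le> 0 + l + 0" using ntr by (intro tendsto_lowerbound) auto
  then show ?thesis unfolding d using tendsto_Lim[OF ntr l] by simp
qed

text \<open>Excluding every single point excludes every initial segment. This is how estimates valid
  at all large indices pass to \<open>\<omega>\<close>.\<close>

lemma nonprincipal_ultrafilter_le_sequentially:
  assumes "nonprincipal_ultrafilter \<omega>"
  shows "\<omega> \<le> sequentially"
proof (rule filter_leI)
  fix P :: "nat \<Rightarrow> bool" assume "eventually P sequentially"
  then obtain N where N: "\<And>k. N \<le> k \<Longrightarrow> P k" by (auto simp: eventually_sequentially)
  have "eventually (\<lambda>k. k \<noteq> i) \<omega>" for i
    using assms by (auto simp: nonprincipal_ultrafilter_def ultrafilter_on_nat_def)
  then have "eventually (\<lambda>k. \<forall>i\<in>{..<N}. k \<noteq> i) \<omega>" by (intro eventually_ball_finite) auto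
  then show "eventually P \<omega>"
  proof eventually_elim
    case (elim k)
    then have "\<not> k < N" by auto
    then have "N \<le> k" by simp
    then show ?case by (rule N)
  qed
qed

lemma ultrafilter_not_tendsto_zero:
  fixes f :: "nat \<Rightarrow> real"
  assumes "ultrafilter_on_nat \<omega>" "\<And>k. 0 \<le> f k" "\<not> (f \<longlongrightarrow> 0) \<omega>"
  shows "\<exists>e>0. eventually (\<lambda>k. e \<le> f k) \<omega>"
proof -
  obtain e where "0 < e" "\<not> eventually (\<lambda>k. dist (f k) 0 < e) \<omega>" using assms(3) by (auto simp: tendsto_iff)
  then have "eventually (\<lambda>k. \<not> dist (f k) 0 < e) \<omega>" using assms(1) by (auto simp: ultrafilter_on_nat_def)
  then have "eventually (\<lambda>k. e \<le> f k) \<omega>" 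
    by eventually_elim (use assms(2) in \<open>simp add: dist_real_def not_less\<close>)
  with \<open>0 < e\<close> show ?thesis by blast
qed

section \<open>Lifting to matrices and the diagonal construction\<close>

text \<open>One representative sequence is chosen for each group element, so that the morphism
  property and injectivity become asymptotic statements about matrices.\<close>

lemma linear_sofic_lift:
  assumes G: "group G" and "linear_sofic G"
  obtains \<omega> n f where "nonprincipal_ultrafilter \<omega>" "filterlim n at_top sequentially"
    "\<And>g. g \<in> carrier G \<Longrightarrow> f g \<in> carrier (prodGL n)"
    "\<And>g h. g \<in> carrier G \<Longrightarrow> h \<in> carrier G \<Longrightarrow>
      ((\<lambda>k. rho (f (g \<otimes>\<^bsub>G\<^esub> h) k - f g k * f h k)) \<longlongrightarrow> 0) \<omega>"
    "\<And>g. g \<in> carrier G \<Longrightarrow> g \<noteq> \<one>\<^bsub>G\<^esub> \<Longrightarrow> \<not> ((\<lambda>k. rho (f g k - 1\<^sub>m (n k))) \<longlongrightarrow> 0) \<omega>"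
proof -
  interpret G: group G by fact
  obtain \<omega> n \<phi> where \<omega>: "nonprincipal_ultrafilter \<omega>" and n: "filterlim n at_top sequentially"
    and hom: "\<phi> \<in> hom G (ultraGL \<omega> n)" and inj: "inj_on \<phi> (carrier G)"
    using assms(2) by (auto simp: linear_sofic_def)
  interpret P: group "prodGL n" by (rule group_prodGL)
  interpret N: normal "nullGL \<omega> n" "prodGL n" by (rule normal_nullGL)
  let ?P = "prodGL n" and ?N = "nullGL \<omega> n"
  have "\<exists>a\<in>carrier ?P. \<phi> g = ?N #>\<^bsub>?P\<^esub> a" if "g \<in> carrier G" for g
    using hom_in_carrier[OF hom that] by (auto simp: ultraGL_def carrier_FactGroup)
  then obtain f where f: "\<And>g. g \<in> carrier G \<Longrightarrow> f g \<in> carrier ?P \<and> \<phi> g = ?N #>\<^bsub>?P\<^esub> f g" by metis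
  show thesis
  proof
    show "nonprincipal_ultrafilter \<omega>" "filterlim n at_top sequentially" by fact+
    show "f g \<in> carrier ?P" if "g \<in> carrier G" for g using f that by blast
    show "((\<lambda>k. rho (f (g \<otimes>\<^bsub>G\<^esub> h) k - f g k * f h k)) \<longlongrightarrow> 0) \<omega>"
      if g: "g \<in> carrier G" and h: "h \<in> carrier G" for g h
    proof -
      have gh: "g \<otimes>\<^bsub>G\<^esub> h \<in> carrier G" using g h by simp
      have "\<phi> (g \<otimes>\<^bsub>G\<^esub> h) = \<phi> g <#>\<^bsub>?P\<^esub> \<phi> h"
        using hom_mult[OF hom g h] by (simp add: ultraGL_def FactGroup_def)
      also have "\<dots> = ?N #>\<^bsub>?P\<^esub> (f g \<otimes>\<^bsub>?P\<^esub> f h)"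
        using f[OF g] f[OF h] by (simp add: N.rcos_sum)
      finally have "f (g \<otimes>\<^bsub>G\<^esub> h) \<in> ?N #>\<^bsub>?P\<^esub> (f g \<otimes>\<^bsub>?P\<^esub> f h)"
        using f[OF gh] P.rcos_self[OF _ N.is_subgroup] by metis
      then show ?thesis
        using mem_nullGL_coset_iff[OF P.m_closed f[OF gh, THEN conjunct1]] f[OF g] f[OF h]
        unfolding prodGL_mult by blast
    qed
    show "\<not> ((\<lambda>k. rho (f g k - 1\<^sub>m (n k))) \<longlongrightarrow> 0) \<omega>" if g: "g \<in> carrier G" "g \<noteq> \<one>\<^bsub>G\<^esub>" for g
    proof
      assume "((\<lambda>k. rho (f g k - 1\<^sub>m (n k))) \<longlongrightarrow> 0) \<omega>"
      then have "f g \<in> ?N" using f[OF g(1)] unfolding nullGL_def by blast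
      then have "\<phi> g = ?N" using f[OF g(1)] P.coset_join2[OF _ N.is_subgroup] by metis
      moreover have "group (ultraGL \<omega> n)" unfolding ultraGL_def by (rule N.factorgroup_is_group)
      then have "\<phi> \<one>\<^bsub>G\<^esub> = ?N" using hom_one[OF hom G] by (simp add: ultraGL_def FactGroup_def)
      ultimately show False using inj g by (metis G.one_closed inj_onD)
    qed
  qed
qed

theorem mainTheorem7:
  fixes G :: "('g, 'b) monoid_scheme"
  assumes "group G" and "countable (carrier G)" and "linear_sofic G"
  shows "\<exists>\<omega>' m \<Psi>. nonprincipal_ultrafilter \<omega>' \<and> filterlim m at_top sequentially \<and>
           \<Psi> \<in> hom G (ultraGL \<omega>' m) \<and>
           (\<forall>g \<in> carrier G - {\<one>\<^bsub>G\<^esub>}. d_omega \<omega>' (\<Psi> g) \<one>\<^bsub>ultraGL \<omega>' m\<^esub> \<ge> 1/4)"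
proof -
  interpret G: group G by fact
  obtain \<omega> n f where \<omega>: "nonprincipal_ultrafilter \<omega>" and n: "filterlim n at_top sequentially"
    and f: "\<And>g. g \<in> carrier G \<Longrightarrow> f g \<in> carrier (prodGL n)"
    and f_mult: "\<And>g h. g \<in> carrier G \<Longrightarrow> h \<in> carrier G \<Longrightarrow>
      ((\<lambda>k. rho (f (g \<otimes>\<^bsub>G\<^esub> h) k - f g k * f h k)) \<longlongrightarrow> 0) \<omega>"
    and f_inj: "\<And>g. g \<in> carrier G \<Longrightarrow> g \<noteq> \<one>\<^bsub>G\<^esub> \<Longrightarrow> \<not> ((\<lambda>k. rho (f g k - 1\<^sub>m (n k))) \<longlongrightarrow> 0) \<omega>"
    using linear_sofic_lift[OF assms(1,3)] by blast
  have ultra: "ultrafilter_on_nat \<omega>" using \<omega> by (simp add: nonprincipal_ultrafilter_def)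
  then have ntr: "\<omega> \<noteq> bot" by (simp add: ultrafilter_on_nat_def)
  have le_seq: "\<omega> \<le> sequentially" by (rule nonprincipal_ultrafilter_le_sequentially[OF \<omega>])
  have fc: "f g k \<in> carrier_mat (n k) (n k)" "invertible_mat (f g k)" if "g \<in> carrier G" for g k
    using f[OF that] by (auto simp: prodGL_carrier)
  define e where "e = from_nat_into (carrier G)"
  have e: "e i \<in> carrier G" for i unfolding e_def by (rule from_nat_into) auto
  have e_surj: "\<exists>i. g = e i" if "g \<in> carrier G" for g
    unfolding e_def using from_nat_into_surj[OF assms(2) that] by metis
  \<comment> \<open>The identity gets an arbitrary positive value, so that \<open>d\<close> is
    positive on the whole enumeration.\<close>
  have "\<exists>d>0. e i \<noteq> \<one>\<^bsub>G\<^esub> \<longrightarrow> eventually (\<lambda>k. d \<le> rho (f (e i) k - 1\<^sub>m (n k))) \<omega>" for i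
  proof (cases "e i = \<one>\<^bsub>G\<^esub>")
    case True then show ?thesis by (intro exI[of _ 1]) auto
  next
    case False
    then show ?thesis using ultrafilter_not_tendsto_zero[OF ultra rho_nonneg f_inj[OF e False]] by blast
  qed
  then obtain d where d_pos: "\<And>i. 0 < d i"
    and d: "\<And>i. e i \<noteq> \<one>\<^bsub>G\<^esub> \<Longrightarrow> eventually (\<lambda>k. d i \<le> rho (f (e i) k - 1\<^sub>m (n k))) \<omega>" by metis
  \<comment> \<open>The gaps \<open>d i\<close> may tend to 0, so the number of squarings depends on
    the finite stage \<open>K\<close>.\<close>
  have "\<exists>N. \<forall>i\<in>{..K}. 1/4 \<le> (5/4::real) ^ N * (d i / 2)" for K
  proof -
    have "eventually (\<lambda>N. 1/4 \<le> (5/4::real) ^ N * (d i / 2)) sequentially" for i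
    proof -
      have "filterlim (\<lambda>N. (5/4::real) ^ N) at_top sequentially"
        by (intro filterlim_at_infinity_imp_filterlim_at_top filterlim_realpow_sequentially_gt1) auto
      then have "eventually (\<lambda>N. 1 / (2 * d i) \<le> (5/4::real) ^ N) sequentially"
        by (simp add: filterlim_at_top)
      then show ?thesis by eventually_elim (use d_pos[of i] in \<open>simp add: field_simps\<close>)
    qed
    then have "eventually (\<lambda>N. \<forall>i\<in>{..K}. 1/4 \<le> (5/4::real) ^ N * (d i / 2)) sequentially"
      by (intro eventually_ball_finite) auto
    then show ?thesis using eventually_happens'[OF sequentially_bot] by blast
  qed
  then obtain N where N: "\<And>K i. i \<le> K \<Longrightarrow> 1/4 \<le> (5/4::real) ^ N K * (d i / 2)" by (metis atMost_iff)
  \<comment> \<open>The tolerance is chosen so that a loss of 2^N(K) leaves 1/(K+1). Finitely many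
    conditions hold eventually along the proper filter \<open>\<omega>\<close>, hence at a common
    \<open>k\<close>; \<open>Suc K\<close> keeps the dimension positive also for K = 0.\<close>
  have "\<exists>k. Suc K \<le> n k \<and> (\<forall>i\<in>{..K}. \<forall>j\<in>{..K}.
      rho (f (e i \<otimes>\<^bsub>G\<^esub> e j) k - f (e i) k * f (e j) k) \<le> 1 / (2 ^ N K * real (Suc K))) \<and>
      (\<forall>i\<in>{..K}. e i \<noteq> \<one>\<^bsub>G\<^esub> \<longrightarrow> d i \<le> rho (f (e i) k - 1\<^sub>m (n k)))" for K
  proof -
    have "eventually (\<lambda>k. Suc K \<le> n k) \<omega>"
      using n le_seq by (simp add: filterlim_at_top filter_leD)
    moreover have "eventually (\<lambda>k. \<forall>i\<in>{..K}. \<forall>j\<in>{..K}.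
      rho (f (e i \<otimes>\<^bsub>G\<^esub> e j) k - f (e i) k * f (e j) k) \<le> 1 / (2 ^ N K * real (Suc K))) \<omega>"
    proof (intro eventually_ball_finite ballI)
      fix i j
      have "eventually (\<lambda>k. rho (f (e i \<otimes>\<^bsub>G\<^esub> e j) k - f (e i) k * f (e j) k) < 1 / (2 ^ N K * real (Suc K))) \<omega>"
        by (rule order_tendstoD(2)[OF f_mult[OF e e]]) simp
      then show "eventually (\<lambda>k. rho (f (e i \<otimes>\<^bsub>G\<^esub> e j) k - f (e i) k * f (e j) k) \<le> 1 / (2 ^ N K * real (Suc K))) \<omega>"
        by eventually_elim simp
    qed auto
    moreover have "eventually (\<lambda>k. \<forall>i\<in>{..K}. e i \<noteq> \<one>\<^bsub>G\<^esub> \<longrightarrow> d i \<le> rho (f (e i) k - 1\<^sub>m (n k))) \<omega>"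
    proof (intro eventually_ball_finite ballI)
      fix i
      show "eventually (\<lambda>k. e i \<noteq> \<one>\<^bsub>G\<^esub> \<longrightarrow> d i \<le> rho (f (e i) k - 1\<^sub>m (n k))) \<omega>"
        using d[of i] by (cases "e i = \<one>\<^bsub>G\<^esub>") auto
    qed auto
    ultimately show ?thesis
      by (intro eventually_happens'[OF ntr] eventually_conj)
  qed
  then obtain \<kappa> where \<kappa>_n: "\<And>K. Suc K \<le> n (\<kappa> K)"
    and \<kappa>_mult: "\<And>K i j. i \<le> K \<Longrightarrow> j \<le> K \<Longrightarrow> 
      rho (f (e i \<otimes>\<^bsub>G\<^esub> e j) (\<kappa> K) - f (e i) (\<kappa> K) * f (e j) (\<kappa> K)) \<le> 1 / (2 ^ N K * real (Suc K))"
    and \<kappa>_gap: "\<And>K i. i \<le> K \<Longrightarrow> e i \<noteq> \<one>\<^bsub>G\<^esub> \<Longrightarrow> d i \<le> rho (f (e i) (\<kappa> K) - 1\<^sub>m (n (\<kappa> K)))"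
    by (metis atMost_iff)
  \<comment> \<open>The stage \<open>K\<close> becomes the new index. The choice of coordinates need
    not be monotone, since only bounds valid for all large \<open>K\<close> are used.\<close>
  define m where "m = (\<lambda>K. amp_dim (N K) (n (\<kappa> K)))"
  define \<psi> where "\<psi> = (\<lambda>g K. amp (N K) (f g (\<kappa> K)))"
  define \<Psi> where "\<Psi> = (\<lambda>g. nullGL \<omega> m #>\<^bsub>prodGL m\<^esub> \<psi> g)"
  have m_ge: "Suc K \<le> m K" for K
    using \<kappa>_n[of K] amp_dim_ge[of "n (\<kappa> K)" "N K"] unfolding m_def by linarith
  have m: "filterlim m at_top sequentially"
    by (rule filterlim_at_top_mono[OF filterlim_ident], rule always_eventually)
      (use m_ge Suc_leD in blast)
  have \<psi>: "\<psi> g \<in> carrier (prodGL m)" if "g \<in> carrier G" for g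
    using fc[OF that] by (auto simp: prodGL_carrier \<psi>_def m_def intro: amp_invertible)
  interpret P: group "prodGL m" by (rule group_prodGL)
  interpret N: normal "nullGL \<omega> m" "prodGL m" by (rule normal_nullGL)
  have \<psi>_mult: "((\<lambda>K. rho (\<psi> (g \<otimes>\<^bsub>G\<^esub> h) K - \<psi> g K * \<psi> h K)) \<longlongrightarrow> 0) \<omega>"
    if g: "g \<in> carrier G" and h: "h \<in> carrier G" for g h
  proof -
    \<comment> \<open>Only the two factors have to occur among the first elements; the product may
      appear anywhere in the enumeration.\<close>
    obtain i j where ij: "g = e i" "h = e j" using e_surj g h by metis
    have "rho (\<psi> (g \<otimes>\<^bsub>G\<^esub> h) K - \<psi> g K * \<psi> h K) \<le> 1 / real (Suc K)" if K: "i \<le> K" "j \<le> K" for K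
    proof -
      note c = fc(1)[OF g, of "\<kappa> K"] fc(1)[OF h, of "\<kappa> K"]
      have "\<psi> g K * \<psi> h K = amp (N K) (f g (\<kappa> K) * f h (\<kappa> K))" unfolding \<psi>_def amp_mult[OF c] ..
      then have "rho (\<psi> (g \<otimes>\<^bsub>G\<^esub> h) K - \<psi> g K * \<psi> h K) \<le> 
          2 ^ N K * rho (f (g \<otimes>\<^bsub>G\<^esub> h) (\<kappa> K) - f g (\<kappa> K) * f h (\<kappa> K))"
        using rho_amp_diff_le[OF fc(1)[OF G.m_closed[OF g h], of "\<kappa> K"] mult_carrier_mat[OF c]] \<kappa>_n[of K]
        by (simp add: \<psi>_def)
      also have "\<dots> \<le> 2 ^ N K * (1 / (2 ^ N K * real (Suc K)))"
        unfolding ij by (intro mult_left_mono \<kappa>_mult K) auto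
      finally show ?thesis by simp
    qed
    then have "eventually (\<lambda>K. rho (\<psi> (g \<otimes>\<^bsub>G\<^esub> h) K - \<psi> g K * \<psi> h K) \<le> 1 / real (Suc K)) sequentially"
      using eventually_ge_at_top[of "max i j"] by (auto elim!: eventually_mono)
    then have "((\<lambda>K. rho (\<psi> (g \<otimes>\<^bsub>G\<^esub> h) K - \<psi> g K * \<psi> h K)) \<longlongrightarrow> 0) sequentially"
      by (intro tendsto_sandwich[OF _ _ tendsto_const lim_inverse_n'[THEN LIMSEQ_Suc]])
        (simp_all add: rho_nonneg)
    then show ?thesis using le_seq by (rule tendsto_mono[rotated])
  qed
  have "\<Psi> \<in> hom G (ultraGL \<omega> m)"
  proof (rule homI)
    show "\<Psi> g \<in> carrier (ultraGL \<omega> m)" if "g \<in> carrier G" for g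
      using \<psi>[OF that] by (simp add: \<Psi>_def ultraGL_def carrier_FactGroup)
    show "\<Psi> (g \<otimes>\<^bsub>G\<^esub> h) = \<Psi> g \<otimes>\<^bsub>ultraGL \<omega> m\<^esub> \<Psi> h" if g: "g \<in> carrier G" and h: "h \<in> carrier G" for g h
    proof -
      have "\<Psi> g \<otimes>\<^bsub>ultraGL \<omega> m\<^esub> \<Psi> h = nullGL \<omega> m #>\<^bsub>prodGL m\<^esub> (\<psi> g \<otimes>\<^bsub>prodGL m\<^esub> \<psi> h)"
        using N.rcos_sum[OF \<psi>[OF g] \<psi>[OF h]] by (simp add: \<Psi>_def ultraGL_def FactGroup_def)
      moreover have "\<psi> (g \<otimes>\<^bsub>G\<^esub> h) \<in> nullGL \<omega> m #>\<^bsub>prodGL m\<^esub> (\<psi> g \<otimes>\<^bsub>prodGL m\<^esub> \<psi> h)"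
        unfolding mem_nullGL_coset_iff[OF P.m_closed[OF \<psi>[OF g] \<psi>[OF h]] \<psi>[OF G.m_closed[OF g h]]]
        unfolding prodGL_mult by (rule \<psi>_mult[OF g h])
      ultimately show ?thesis
        using P.repr_independence[OF _ P.m_closed[OF \<psi>[OF g] \<psi>[OF h]] N.is_subgroup]
        unfolding \<Psi>_def by metis
    qed
  qed
  moreover have "1/4 \<le> d_omega \<omega> (\<Psi> g) \<one>\<^bsub>ultraGL \<omega> m\<^esub>" if g: "g \<in> carrier G - {\<one>\<^bsub>G\<^esub>}" for g
  proof -
    have gc: "g \<in> carrier G" using g by simp
    obtain i where i: "g = e i" using e_surj gc by metis
    have ge: "1/4 \<le> rho (\<psi> g K - 1\<^sub>m (m K))" if K: "i \<le> K" for K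
    proof -
      let ?A = "f g (\<kappa> K)" and ?n = "n (\<kappa> K)"
      note A = fc[OF gc, of "\<kappa> K"]
      have A1: "?A - 1\<^sub>m ?n \<in> carrier_mat ?n ?n" by (intro minus_carrier_mat) simp
      have n0: "0 < ?n" using \<kappa>_n[of K] by simp
      have gap: "d i \<le> rho (?A - 1\<^sub>m ?n)" using \<kappa>_gap[OF K] g i by simp
      then have "d i * real ?n \<le> real (mrank (?A - 1\<^sub>m ?n))"
        using n0 by (simp add: rho_eq[OF A1] field_simps)
      moreover have "d i \<le> 1" using gap rho_le_one[OF A1] by simp
      \<comment> \<open>The bound for all scalars is now specialized to the scalar 1.\<close>
      ultimately have "min ((5/4) ^ N K * (d i / 2)) (1/4) * real (m K)
          \<le> real (mrank (\<psi> g K - 1 \<cdot>\<^sub>m 1\<^sub>m (m K)))"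
        unfolding \<psi>_def m_def by (rule scalar_gap_amp[OF A])
      moreover have "(1::complex) \<cdot>\<^sub>m 1\<^sub>m (m K) = 1\<^sub>m (m K)" by (intro eq_matI) auto
      moreover have "min ((5/4) ^ N K * (d i / 2)) (1/4) = 1/4" using N[OF K] by simp
      ultimately have "1/4 * real (m K) \<le> real (mrank (\<psi> g K - 1\<^sub>m (m K)))" by simp
      moreover have "\<psi> g K - 1\<^sub>m (m K) \<in> carrier_mat (m K) (m K)" by (intro minus_carrier_mat) simp
      ultimately show ?thesis using m_ge[of K] by (simp add: rho_eq[of _ "m K" "m K"] field_simps)
    qed
    have "eventually (\<lambda>K. 1/4 \<le> rho (\<psi> g K - 1\<^sub>m (m K))) sequentially"
      by (rule eventually_mono[OF eventually_ge_at_top[of i] ge])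
    then have "eventually (\<lambda>K. 1/4 \<le> rho (\<psi> g K - 1\<^sub>m (m K))) \<omega>" using le_seq by (auto dest: filter_leD)
    then show ?thesis unfolding \<Psi>_def by (rule d_omega_coset_ge[OF ultra \<psi>[OF gc]])
  qed
  ultimately show ?thesis using \<omega> m by blast
qed

end
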